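(* Let $F$ be a Generalized Flowerbed of size $n$ such that at least one of its blue or red Generalized Flowers has height at least $2$, no blue and red Generalized Flower form a canceling pair, and a weakest Generalized Flower of $F$ is red. Then under both normal and misère play Left has a winning move (Left wins moving first). Moreover, if $n\ge2$, Left has a first move that is winning under both normal and misère play.
   Context: Hackenbush: finite graph with blue, red or green edges and ground vertices; Left cuts blue or green edges, Right cuts red or green; components disconnected from the ground are discarded. Normal play: last mover wins; misère play: last mover loses. A Stalk of height $h$ is a path of $h$ green edges on the ground. A Generalized Flower $*_h:(x)$ is a green path of $h\ge1$ edges (stem) whose bottom vertex is the only ground vertex, with a red–blue Hackenbush position (Blossom) attached at the top vertex, $x$ being the normal-play value of the Blossom (blossom value); it is blue if $x>0$, red if $x<0$. A Generalized Flowerbed of size $n$ is a disjunctive sum of $n$ blue Generalized Flowers, $n$ red Generalized Flowers and a (possibly empty) sum of Stalks. $*_{h_1}:(x_1)$ is weaker than $*_{h_2}:(x_2)$ if $h_1>h_2$, or $h_1=h_2$ and $|x_1|<|x_2|$. A blue and a red Generalized Flower cancel if they have the same height and blossom values $x$ and $-x$. *)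

theory Defs
  imports Main "HOL-Library.FSet" "HOL-Library.Multiset" "HOL-Library.Uprod"
begin

section \<open>Short partizan games\<close>

datatype player = Left | Right

fun opponent :: "player \<Rightarrow> player" where
  "opponent Left = Right"
| "opponent Right = Left"

datatype convention = Normal | Misere

datatype game = Game (left_opts: "game fset") (right_opts: "game fset")

fun options_of :: "player \<Rightarrow> game \<Rightarrow> game fset" where
  "options_of Left G = left_opts G"
| "options_of Right G = right_opts G"

lemma size_left_opts [termination_simp]:
  "G' |\<in>| left_opts G \<Longrightarrow> size G' < size G"
proof (cases G)
  case (Game L R)
  assume "G' |\<in>| left_opts G"
  then have "Suc (size G') \<le> (\<Sum>x\<in>fset L. Suc (size x))"
    using Game by (intro member_le_sum) auto
  then show ?thesis using Game by simp
qed

lemma size_right_opts [termination_simp]: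
  "G' |\<in>| right_opts G \<Longrightarrow> size G' < size G"
proof (cases G)
  case (Game L R)
  assume "G' |\<in>| right_opts G"
  then have "Suc (size G') \<le> (\<Sum>x\<in>fset R. Suc (size x))"
    using Game by (intro member_le_sum) auto
  then show ?thesis using Game by simp
qed

lemma size_options_of [termination_simp]:
  "G' |\<in>| options_of p G \<Longrightarrow> size G' < size G"
  by (cases p) (auto intro: size_left_opts size_right_opts)

text \<open>A player who cannot move loses under normal play (the opponent moved last) and wins
  under misere play.\<close>

function wins_first :: "convention \<Rightarrow> player \<Rightarrow> game \<Rightarrow> bool" where
  "wins_first c p G \<longleftrightarrow>
     (if options_of p G = {||} then c = Misere
      else \<exists>G' \<in> fset (options_of p G). \<not> wins_first c (opponent p) G')"
  by pat_completeness auto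
termination
  by (relation "measure (\<lambda>(c, p, G). size G)") (auto intro: size_options_of)

declare wins_first.simps [simp del]

definition winning_move :: "convention \<Rightarrow> player \<Rightarrow> game \<Rightarrow> game \<Rightarrow> bool" where
  "winning_move c p G G' \<longleftrightarrow> G' |\<in>| options_of p G \<and> \<not> wins_first c (opponent p) G'"

text \<open>Disjunctive sum. Options are sets, so it is associative and commutative up to equality of
  game trees, not merely up to equality of values.\<close>

instantiation game :: comm_monoid_add
begin

definition zero_game :: game where
  "0 = Game {||} {||}"

function plus_game :: "game \<Rightarrow> game \<Rightarrow> game" where
  "plus_game G H = Game
     ((\<lambda>G'. plus_game G' H) |`| left_opts G |\<union>| (\<lambda>H'. plus_game G H') |`| left_opts H)
     ((\<lambda>G'. plus_game G' H) |`| right_opts G |\<union>| (\<lambda>H'. plus_game G H') |`| right_opts H)"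
  by pat_completeness auto
termination
  by (relation "measure (\<lambda>(G, H). size G + size H)")
    (auto intro: size_left_opts size_right_opts)

declare plus_game.simps [simp del]

lemma left_opts_plus [simp]:
  "left_opts (G + H) =
     (\<lambda>G'. G' + H) |`| left_opts G |\<union>| (\<lambda>H'. G + H') |`| left_opts H"
  by (subst plus_game.simps) simp

lemma right_opts_plus [simp]:
  "right_opts (G + H) =
     (\<lambda>G'. G' + H) |`| right_opts G |\<union>| (\<lambda>H'. G + H') |`| right_opts H"
  by (subst plus_game.simps) simp

instance
proof
  fix G H K :: game
  show "G + H + K = G + (H + K)"
  proof (induction "size G + size H + size K" arbitrary: G H K rule: less_induct)
    case less
    have IH: "G' + H' + K' = G' + (H' + K')"
      if "size G' + size H' + size K' < size G + size H + size K" for G' H' K' :: game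
      using that by (rule less)
    have L: "G' + H + K = G' + (H + K)" if "size G' < size G" for G' using IH that by simp
    have M: "G + H' + K = G + (H' + K)" if "size H' < size H" for H' using IH that by simp
    have R: "G + H + K' = G + (H + K')" if "size K' < size K" for K' using IH that by simp
    show ?case
      by (rule game.expand)
        (auto simp: fimage_funion fset.map_comp comp_def funion_assoc L M R
          size_left_opts size_right_opts cong: fset.map_cong)
  qed
  show "G + H = H + G"
  proof (induction "size G + size H" arbitrary: G H rule: less_induct)
    case less
    have L: "G' + H = H + G'" if "size G' < size G" for G' using less that by simp
    have R: "G + H' = H' + G" if "size H' < size H" for H' using less that by simp
    show ?case
      by (rule game.expand)
        (auto simp: funion_commute L R size_left_opts size_right_opts cong: fset.map_cong)
  qed
  show "0 + G = G"
  proof (induction G)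
    case (Game L R)
    then show ?case
      by (intro game.expand) (auto simp: zero_game_def fset.map_ident cong: fset.map_cong)
  qed
qed

end

instantiation game :: uminus
begin

primrec uminus_game :: "game \<Rightarrow> game" where
  "uminus_game (Game L R) = Game (uminus_game |`| R) (uminus_game |`| L)"

instance ..

end


section \<open>Normal-play values\<close>

text \<open>\<open>H\<close> is at least as good as \<open>G\<close> for Left in every sum.\<close>

definition game_le :: "game \<Rightarrow> game \<Rightarrow> bool" where
  "game_le G H \<longleftrightarrow>
     (\<forall>X. (wins_first Normal Left (G + X) \<longrightarrow> wins_first Normal Left (H + X)) \<and>
          (wins_first Normal Right (H + X) \<longrightarrow> wins_first Normal Right (G + X)))"

definition game_eq :: "game \<Rightarrow> game \<Rightarrow> bool" where
  "game_eq G H \<longleftrightarrow> game_le G H \<and> game_le H G"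

lemma game_le_refl: "game_le G G"
  by (simp add: game_le_def)

lemma game_le_trans: "game_le G H \<Longrightarrow> game_le H K \<Longrightarrow> game_le G K"
  by (simp add: game_le_def)

lemma uminus_plus_game: "- (G + H) = - G + - (H :: game)"
proof (induction "size G + size H" arbitrary: G H rule: less_induct)
  case less
  have L: "- (G' + H) = - G' + - H" if "size G' < size G" for G' using less that by simp
  have R: "- (G + H') = - G + - H'" if "size H' < size H" for H' using less that by simp
  have u: "left_opts (- K) = uminus |`| right_opts K"
    "right_opts (- K) = uminus |`| left_opts K" for K :: game
    by (cases K; simp)+
  show ?case
    by (rule game.expand)
      (auto simp: u fimage_funion fset.map_comp comp_def L R
        size_left_opts size_right_opts cong: fset.map_cong)
qed

lemma uminus_uminus_game: "- (- G) = (G :: game)"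
  by (induction G) (auto simp: fset.map_comp comp_def fset.map_ident cong: fset.map_cong)

lemma options_of_uminus: "options_of p (- G) = uminus |`| options_of (opponent p) G"
  by (cases p; cases G; simp)

lemma opponent_opponent [simp]: "opponent (opponent p) = p"
  by (cases p) auto

lemma wins_first_uminus: "wins_first c p (- G) = wins_first c (opponent p) G"
proof (induction G arbitrary: p rule: measure_induct_rule[of size])
  case (less G)
  have "wins_first c (opponent p) (- G') = wins_first c p G'"
    if "G' \<in> fset (options_of (opponent p) G)" for G'
    using less[of G' "opponent p"] that by (simp add: size_options_of)
  then show ?case
    by (subst (1 2) wins_first.simps) (auto simp: options_of_uminus)
qed

lemma game_le_uminus: "game_le G H \<Longrightarrow> game_le (- H) (- G)"
proof -
  assume le: "game_le G H"
  have eq: "- K + X = - (K + - X)" for K X :: game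
    by (simp add: uminus_plus_game uminus_uminus_game)
  show ?thesis
    using le by (auto simp: game_le_def eq wins_first_uminus)
qed

quotient_type "value" = game / game_eq
  morphisms rep_value "value_of"
  by (rule equivpI)
    (auto simp: reflp_def symp_def transp_def game_eq_def intro: game_le_refl game_le_trans)

text \<open>The absolute value is meaningful for values comparable with \<open>0\<close>, in particular for the
  values of red-blue Hackenbush positions, which are numbers.\<close>

instantiation "value" :: "{order, zero, uminus, abs}"
begin

lift_definition zero_value :: "value" is "0 :: game" .

lift_definition uminus_value :: "value \<Rightarrow> value" is "uminus :: game \<Rightarrow> game"
  by (auto simp: game_eq_def intro: game_le_uminus)

lift_definition less_eq_value :: "value \<Rightarrow> value \<Rightarrow> bool" is game_le
  by (auto simp: game_eq_def intro: game_le_trans)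

definition less_value :: "value \<Rightarrow> value \<Rightarrow> bool" where
  "less_value x y \<longleftrightarrow> x \<le> y \<and> \<not> y \<le> x"

definition abs_value :: "value \<Rightarrow> value" where
  "abs_value x = (if 0 \<le> x then x else - x)"

instance
proof
  fix x y z :: "value"
  show "x < y \<longleftrightarrow> x \<le> y \<and> \<not> y \<le> x" by (rule less_value_def)
  show "x \<le> x" by transfer (rule game_le_refl)
  show "x \<le> y \<Longrightarrow> y \<le> z \<Longrightarrow> x \<le> z" by transfer (rule game_le_trans)
  show "x \<le> y \<Longrightarrow> y \<le> x \<Longrightarrow> x = y" by transfer (simp add: game_eq_def)
qed

end


section \<open>Hackenbush\<close>

datatype colour = Blue | Red | Green

text \<open>A finite multigraph; loops are allowed. The vertices are the ground vertices and the
  endpoints of edges, other isolated vertices being irrelevant. Outside the edge set, the functions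
  \<open>ends\<close> and \<open>colour_of\<close> carry no meaning.\<close>

record ('v, 'e) hackenbush =
  edges :: "'e fset"
  ends :: "'e \<Rightarrow> 'v uprod"
  colour_of :: "'e \<Rightarrow> colour"
  ground :: "'v fset"

inductive connected_to_ground :: "('v, 'e) hackenbush \<Rightarrow> 'v \<Rightarrow> bool" for P where
  ground: "v |\<in>| ground P \<Longrightarrow> connected_to_ground P v"
| edge: "connected_to_ground P v \<Longrightarrow> e |\<in>| edges P \<Longrightarrow> ends P e = Upair v w \<Longrightarrow>
    connected_to_ground P w"

definition discard :: "('v, 'e) hackenbush \<Rightarrow> ('v, 'e) hackenbush" where
  "discard P =
     P\<lparr>edges := ffilter (\<lambda>e. \<forall>v \<in> set_uprod (ends P e). connected_to_ground P v) (edges P)\<rparr>"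

definition cut :: "'e \<Rightarrow> ('v, 'e) hackenbush \<Rightarrow> ('v, 'e) hackenbush" where
  "cut e P = discard (P\<lparr>edges := edges P |-| {|e|}\<rparr>)"

fun may_cut :: "player \<Rightarrow> colour \<Rightarrow> bool" where
  "may_cut Left k \<longleftrightarrow> k = Blue \<or> k = Green"
| "may_cut Right k \<longleftrightarrow> k = Red \<or> k = Green"

lemma fcard_edges_cut:
  "e |\<in>| edges P \<Longrightarrow> fcard (edges (cut e P)) < fcard (edges P)"
  by (rule pfsubset_fcard_mono) (auto simp: cut_def discard_def)

function game_of :: "('v, 'e) hackenbush \<Rightarrow> game" where
  "game_of P = Game
     ((\<lambda>e. game_of (cut e P)) |`| ffilter (\<lambda>e. may_cut Left (colour_of P e)) (edges P))
     ((\<lambda>e. game_of (cut e P)) |`| ffilter (\<lambda>e. may_cut Right (colour_of P e)) (edges P))"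
  by pat_completeness auto
termination
  by (relation "measure (\<lambda>P. fcard (edges P))") (auto intro: fcard_edges_cut)

declare game_of.simps [simp del]

definition grounded :: "('v, 'e) hackenbush \<Rightarrow> bool" where
  "grounded P \<longleftrightarrow> (\<forall>e. e |\<in>| edges P \<longrightarrow> (\<forall>v \<in> set_uprod (ends P e). connected_to_ground P v))"

definition red_blue :: "('v, 'e) hackenbush \<Rightarrow> bool" where
  "red_blue P \<longleftrightarrow> (\<forall>e. e |\<in>| edges P \<longrightarrow> colour_of P e \<noteq> Green)"


section \<open>Stalks, Generalized Flowers and Generalized Flowerbeds\<close>

definition stalk :: "nat \<Rightarrow> (nat, nat) hackenbush" where
  "stalk h = \<lparr>edges = fset_of_list [0..<h], ends = (\<lambda>i. Upair i (Suc i)),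
     colour_of = (\<lambda>_. Green), ground = {|0|}\<rparr>"

datatype ('v, 'e) flower = Flower (height: nat) (blossom: "('v, 'e) hackenbush")

text \<open>The Blossom is attached by identifying all its ground vertices with the top of the stem.\<close>

definition flower_position :: "('v, 'e) flower \<Rightarrow> (nat + 'v, nat + 'e) hackenbush" where
  "flower_position f = (let S = stalk (height f); B = blossom f in
     \<lparr>edges = Inl |`| edges S |\<union>| Inr |`| edges B,
      ends = case_sum
        (\<lambda>i. map_uprod Inl (ends S i))
        (\<lambda>e. map_uprod (\<lambda>v. if v |\<in>| ground B then Inl (height f) else Inr v) (ends B e)),
      colour_of = case_sum (colour_of S) (colour_of B),
      ground = Inl |`| ground S\<rparr>)"

definition blossom_value :: "('v, 'e) flower \<Rightarrow> value" where
  "blossom_value f = value_of (game_of (blossom f))"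

definition generalized_flower :: "('v, 'e) flower \<Rightarrow> bool" where
  "generalized_flower f \<longleftrightarrow> 1 \<le> height f \<and> grounded (blossom f) \<and> red_blue (blossom f)"

definition blue_flower :: "('v, 'e) flower \<Rightarrow> bool" where
  "blue_flower f \<longleftrightarrow> generalized_flower f \<and> blossom_value f > 0"

definition red_flower :: "('v, 'e) flower \<Rightarrow> bool" where
  "red_flower f \<longleftrightarrow> generalized_flower f \<and> blossom_value f < 0"

definition weaker :: "('v, 'e) flower \<Rightarrow> ('v, 'e) flower \<Rightarrow> bool" where
  "weaker f g \<longleftrightarrow> height f > height g \<or>
     height f = height g \<and> \<bar>blossom_value f\<bar> < \<bar>blossom_value g\<bar>"

definition cancel :: "('v, 'e) flower \<Rightarrow> ('v, 'e) flower \<Rightarrow> bool" where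
  "cancel b r \<longleftrightarrow> height b = height r \<and> blossom_value r = - blossom_value b"

datatype ('v, 'e) flowerbed = Flowerbed
  (blue_flowers: "('v, 'e) flower multiset")
  (red_flowers: "('v, 'e) flower multiset")
  (stalk_heights: "nat multiset")

definition generalized_flowerbed :: "nat \<Rightarrow> ('v, 'e) flowerbed \<Rightarrow> bool" where
  "generalized_flowerbed n F \<longleftrightarrow>
     size (blue_flowers F) = n \<and> (\<forall>f \<in># blue_flowers F. blue_flower f) \<and>
     size (red_flowers F) = n \<and> (\<forall>f \<in># red_flowers F. red_flower f)"

definition flowerbed_game :: "('v, 'e) flowerbed \<Rightarrow> game" where
  "flowerbed_game F =
     (\<Sum>f \<in># blue_flowers F. game_of (flower_position f)) +
     (\<Sum>f \<in># red_flowers F. game_of (flower_position f)) +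
     (\<Sum>h \<in># stalk_heights F. game_of (stalk h))"

definition weakest_in :: "('v, 'e) flower \<Rightarrow> ('v, 'e) flowerbed \<Rightarrow> bool" where
  "weakest_in f F \<longleftrightarrow> f \<in># blue_flowers F + red_flowers F \<and>
     (\<forall>g \<in># blue_flowers F + red_flowers F. \<not> weaker g f)"

end

theory Submission
  imports Defs
begin

text \<open>A colon principle valid under both conventions lets a Blossom be replaced by any Blossom that is
  better for the player, and red-blue positions are numbers, hence comparable. Call the excess of
  blue over red Flowers the advantage. Destroying a red Flower raises it, so by induction Left wins
  moving second with advantage \<open>2\<close> and moving first with advantage \<open>1\<close>; the base case is a single
  blue Flower plus Nim. With advantage \<open>0\<close> and \<open>n \<ge> 2\<close>, Left destroys a red Flower other than the
  weakest one: any answer except destroying a blue Flower leaves advantage \<open>1\<close>, and that answer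
  leads to a smaller position of the same kind, since the weakest Flower, of maximal height, is
  still there.

  For \<open>n = 1\<close> let \<open>h\<close> be the height of the blue Flower. Left would like to shorten the red one to a
  Stalk \<open>j\<close> such that no Stalk \<open>i < h\<close> in place of the blue Flower makes the remaining Nim position
  losing for the player to move. If the red Flower is higher, some \<open>j \<le> h\<close> works by the pigeonhole
  principle. If the heights agree and no such \<open>j < h\<close> exists, the blossom values decide: Left can
  keep both the sum of the blossom values nonnegative and the Nim position with two heaps \<open>h\<close> added
  losing for the player to move, and then answers Right's shortening of the blue Flower by shortening
  the red one.\<close>

section \<open>Order and numeric games\<close>

lemma wins_firstI:
  "G' |\<in>| options_of p G \<Longrightarrow> \<not> wins_first c (opponent p) G' \<Longrightarrow> wins_first c p G"
  by (subst wins_first.simps) auto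

lemma not_wins_firstI:
  assumes "c = Normal \<or> options_of p G \<noteq> {||}"
    and "\<And>G'. G' |\<in>| options_of p G \<Longrightarrow> wins_first c (opponent p) G'"
  shows "\<not> wins_first c p G"
  using assms by (subst wins_first.simps) auto

lemma wins_firstE:
  assumes "wins_first c p G" and "c = Normal \<or> options_of p G \<noteq> {||}"
  obtains G' where "G' |\<in>| options_of p G" and "\<not> wins_first c (opponent p) G'"
  using assms by (subst (asm) wins_first.simps) (auto split: if_splits)

lemma not_wins_firstD:
  "\<not> wins_first c p G \<Longrightarrow> G' |\<in>| options_of p G \<Longrightarrow> wins_first c (opponent p) G'"
  by (rule ccontr) (auto intro: wins_firstI)

lemma wins_first_LeftI:
  "G' |\<in>| options_of Left G \<Longrightarrow> \<not> wins_first c Right G' \<Longrightarrow> wins_first c Left G"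
  by (rule wins_firstI) simp_all

lemma wins_first_LeftE:
  assumes "wins_first c Left G" and "options_of Left G \<noteq> {||}"
  obtains G' where "G' |\<in>| options_of Left G" and "\<not> wins_first c Right G'"
  using wins_firstE[OF assms(1) disjI2[OF assms(2)]] by (metis opponent.simps(1))

lemma in_options_plus:
  "G |\<in>| options_of p (A + B) \<longleftrightarrow>
     (\<exists>A'. A' |\<in>| options_of p A \<and> G = A' + B) \<or> (\<exists>B'. B' |\<in>| options_of p B \<and> G = A + B')"
  by (cases p) auto

lemma options_plusI:
  "A' |\<in>| options_of p A \<Longrightarrow> A' + B |\<in>| options_of p (A + B)"
  "B' |\<in>| options_of p B \<Longrightarrow> A + B' |\<in>| options_of p (A + B)"
  by (auto simp: in_options_plus)

lemma game_eqI: "(\<And>p G. G |\<in>| options_of p A \<longleftrightarrow> G |\<in>| options_of p B) \<Longrightarrow> A = B"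
  by (metis fset_eqI game.expand options_of.simps)

text \<open>The usual test for \<open>G \<le> H\<close>: Left survives as second player in the
  difference \<open>H - G\<close>. Unlike \<open>game_le\<close> it does not quantify over all sums,
  so it unfolds recursively.\<close>

definition left_survives :: "game \<Rightarrow> game \<Rightarrow> bool" where
  "left_survives G H \<longleftrightarrow> \<not> wins_first Normal Right (H + - G)"

text \<open>A Right move in \<open>H - G\<close> is a Right move in \<open>H\<close> or the negative
  of a Left move in \<open>G\<close>. Left is then to move in some \<open>K - L\<close>, and
  negation turns this into Right moving in \<open>L - K\<close>.\<close>

lemma left_survives_iff:
  "left_survives G H \<longleftrightarrow>
     (\<forall>H'. H' |\<in>| right_opts H \<longrightarrow> \<not> left_survives H' G) \<and>
     (\<forall>G'. G' |\<in>| left_opts G \<longrightarrow> \<not> left_survives H G')"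
proof -
  have swap: "wins_first Normal Left (K + - L) \<longleftrightarrow> \<not> left_survives K L" for K L
  proof -
    have "K + - L = - (L + - K)"
      by (simp add: uminus_plus_game uminus_uminus_game add.commute)
    then show ?thesis by (simp add: left_survives_def wins_first_uminus)
  qed
  have "right_opts (- G) = uminus |`| left_opts G"
    using options_of_uminus[of Right G] by simp
  then have "left_survives G H \<longleftrightarrow>
     (\<forall>H'. H' |\<in>| right_opts H \<longrightarrow> wins_first Normal Left (H' + - G)) \<and>
     (\<forall>G'. G' |\<in>| left_opts G \<longrightarrow> wins_first Normal Left (H + - G'))"
    unfolding left_survives_def by (subst wins_first.simps) (auto simp: fset.map_comp)
  then show ?thesis by (simp add: swap)
qed

text \<open>If a Right option \<open>H'\<close> of \<open>G\<close> had
  \<open>left_survives H' G\<close>, one unfolding would give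
  \<open>\<not> left_survives H' H'\<close>, against the induction hypothesis; Left options are
  symmetric.\<close>

lemma left_survives_refl: "left_survives G G"
proof (induction G rule: measure_induct_rule[of size])
  case (less G)
  then show ?case
    by (subst left_survives_iff) (meson left_survives_iff size_left_opts size_right_opts)
qed

text \<open>The ordinal sum with \<open>G\<close> on top of an impartial base whose options form
  \<open>C\<close>: a move in the base removes everything above it.\<close>

primrec above :: "game fset \<Rightarrow> game \<Rightarrow> game" where
  "above C (Game L R) = Game (C |\<union>| above C |`| L) (C |\<union>| above C |`| R)"

lemma left_opts_above [simp]: "left_opts (above C G) = C |\<union>| above C |`| left_opts G"
  by (cases G) simp

lemma right_opts_above [simp]: "right_opts (above C G) = C |\<union>| above C |`| right_opts G"
  by (cases G) simp

lemma above_empty [simp]: "above {||} G = G"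
  by (induction G) (auto simp: fset.map_ident cong: fset.map_cong)

text \<open>The colon principle. A player facing an element of \<open>C\<close> is never out of moves, which is what
  makes it valid under misere play.\<close>

lemma left_survives_above:
  assumes "c = Normal \<or> C \<noteq> {||}" and "left_survives G H"
  shows "(wins_first c Left (above C G + X) \<longrightarrow> wins_first c Left (above C H + X)) \<and>
    (wins_first c Right (above C H + X) \<longrightarrow> wins_first c Right (above C G + X))"
  using assms(2)
proof (induction "size G + size H + size X" arbitrary: G H X rule: less_induct)
  case less
  have L: "wins_first c Left (above C G' + X') \<Longrightarrow> wins_first c Left (above C H' + X')"
    and R: "wins_first c Right (above C H' + X') \<Longrightarrow> wins_first c Right (above C G' + X')"
    if "left_survives G' H'" "size G' + size H' + size X' < size G + size H + size X"
    for G' H' X'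
    using less.hyps[of G' H' X'] that by auto
  have surv: "left_survives K K' \<longleftrightarrow>
     (\<forall>H'. H' |\<in>| right_opts K' \<longrightarrow> \<not> left_survives H' K) \<and>
     (\<forall>G'. G' |\<in>| left_opts K \<longrightarrow> \<not> left_survives K' G')" for K K'
    by (rule left_survives_iff)
  have opt: "c = Normal \<or> options_of p (above C K + X) \<noteq> {||}" for p K
    using assms(1) by (cases p) auto
  show ?case
  proof (intro conjI impI)
    assume "wins_first c Left (above C G + X)"
    then obtain Y where Y: "Y |\<in>| options_of Left (above C G + X)"
        "\<not> wins_first c (opponent Left) Y"
      by (rule wins_firstE[OF _ opt])
    from Y(1) consider (base) D where "D |\<in>| C" "Y = D + X"
      | (top) G' where "G' |\<in>| left_opts G" "Y = above C G' + X"
      | (rest) X' where "X' |\<in>| left_opts X" "Y = above C G + X'"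
      by auto
    then show "wins_first c Left (above C H + X)"
    proof cases
      case base
      then show ?thesis using Y(2) by (intro wins_firstI[of Y]) auto
    next
      case rest
      have "\<not> wins_first c Right (above C H + X')"
        using R[of G H X'] Y(2) rest less.prems size_left_opts by auto
      then show ?thesis using rest by (intro wins_firstI[of "above C H + X'"]) auto
    next
      case top
      have sG: "size G' < size G" using top size_left_opts by auto
      \<comment> \<open>\<open>H \<le> G'\<close> would contradict \<open>G \<le> H\<close>, as
        \<open>G'\<close> is a Left option of \<open>G\<close>. It fails in one of two ways: Left
        has a move \<open>H' \<ge> G'\<close> in \<open>H\<close>, or Right could reverse
        \<open>G'\<close> to some \<open>G'' \<le> H\<close>. In the latter case Left wins after the
        reversal, hence also over \<open>H\<close>.\<close>
      have "\<not> left_survives H G'" using less.prems surv[of G H] top by auto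
      then consider (l) H' where "H' |\<in>| left_opts H" "left_survives G' H'"
        | (r) G'' where "G'' |\<in>| right_opts G'" "left_survives G'' H"
        using surv[of H G'] by auto
      then show ?thesis
      proof cases
        case l
        have "\<not> wins_first c Right (above C H' + X)"
          using R[of G' H' X] Y(2) top l sG size_left_opts[of H' H] by auto
        then show ?thesis using l by (intro wins_firstI[of "above C H' + X"]) auto
      next
        case r
        have "wins_first c Left (above C G'' + X)"
          using not_wins_firstD[OF Y(2), of "above C G'' + X"] top r by auto
        then show ?thesis using L[of G'' H X] r sG size_right_opts[of G'' G'] by auto
      qed
    qed
  next
    assume "wins_first c Right (above C H + X)"
    then obtain Y where Y: "Y |\<in>| options_of Right (above C H + X)"
        "\<not> wins_first c (opponent Right) Y"
      by (rule wins_firstE[OF _ opt])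
    from Y(1) consider (base) D where "D |\<in>| C" "Y = D + X"
      | (top) H' where "H' |\<in>| right_opts H" "Y = above C H' + X"
      | (rest) X' where "X' |\<in>| right_opts X" "Y = above C H + X'"
      by auto
    then show "wins_first c Right (above C G + X)"
    proof cases
      case base
      then show ?thesis using Y(2) by (intro wins_firstI[of Y]) auto
    next
      case rest
      have "\<not> wins_first c Left (above C G + X')"
        using L[of G H X'] Y(2) rest less.prems size_right_opts by auto
      then show ?thesis using rest by (intro wins_firstI[of "above C G + X'"]) auto
    next
      case top
      have sH: "size H' < size H" using top size_right_opts by auto
      have "\<not> left_survives H' G" using less.prems surv[of G H] top by auto
      then consider (l) G' where "G' |\<in>| right_opts G" "left_survives G' H'"
        | (r) H'' where "H'' |\<in>| left_opts H'" "left_survives G H''"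
        using surv[of H' G] by auto
      then show ?thesis
      proof cases
        case l
        have "\<not> wins_first c Left (above C G' + X)"
          using L[of G' H' X] Y(2) top l sH size_right_opts[of G' G] by auto
        then show ?thesis using l by (intro wins_firstI[of "above C G' + X"]) auto
      next
        case r
        have "wins_first c Right (above C H'' + X)"
          using not_wins_firstD[OF Y(2), of "above C H'' + X"] top r by auto
        then show ?thesis using R[of G H'' X] r sH size_left_opts[of H'' H'] by auto
      qed
    qed
  qed
qed

text \<open>Testing with \<open>X = - G\<close> gives one direction; the other is the colon
  principle over the empty base.\<close>

lemma game_le_iff_left_survives: "game_le G H \<longleftrightarrow> left_survives G H"
proof
  assume "game_le G H"
  then have "wins_first Normal Right (H + - G) \<longrightarrow> wins_first Normal Right (G + - G)"
    by (simp add: game_le_def)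
  then show "left_survives G H"
    using left_survives_refl[of G] by (auto simp: left_survives_def)
next
  assume "left_survives G H"
  then show "game_le G H"
    using left_survives_above[of Normal "{||}" G H] by (simp add: game_le_def)
qed

lemma game_le_iff:
  "game_le G H \<longleftrightarrow>
     (\<forall>H'. H' |\<in>| right_opts H \<longrightarrow> \<not> game_le H' G) \<and>
     (\<forall>G'. G' |\<in>| left_opts G \<longrightarrow> \<not> game_le H G')"
  unfolding game_le_iff_left_survives by (rule left_survives_iff)

lemma wins_first_above_mono:
  assumes "C \<noteq> {||}" and "game_le G H"
  shows "wins_first c Left (above C G + X) \<Longrightarrow> wins_first c Left (above C H + X)"
    and "\<not> wins_first c Right (above C G + X) \<Longrightarrow> \<not> wins_first c Right (above C H + X)"
  using left_survives_above[of c C G H X] assms by (auto simp: game_le_iff_left_survives)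

text \<open>Weak inequalities suffice for numbers: by \<open>game_le_iff\<close> and reflexivity no
  Left option is \<open>\<ge> G\<close> and no Right option is \<open>\<le> G\<close>, so they are
  strict automatically.\<close>

inductive numeric :: "game \<Rightarrow> bool" where
  "(\<And>G'. G' |\<in>| left_opts G \<Longrightarrow> numeric G' \<and> game_le G' G) \<Longrightarrow>
   (\<And>G'. G' |\<in>| right_opts G \<Longrightarrow> numeric G' \<and> game_le G G') \<Longrightarrow> numeric G"

lemma numeric_left:
  assumes "numeric G" and "G' |\<in>| left_opts G"
  shows "numeric G'" and "game_le G' G"
  using assms by (auto elim: numeric.cases)

lemma numeric_right:
  assumes "numeric G" and "G' |\<in>| right_opts G"
  shows "numeric G'" and "game_le G G'"
  using assms by (auto elim: numeric.cases)

text \<open>If \<open>H \<le> G\<close> fails, a Right option of \<open>G\<close> is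
  \<open>\<le> H\<close> or a Left option of \<open>H\<close> is \<open>\<ge> G\<close>. For numbers
  this option is itself comparable with its game, so transitivity suffices without
  induction.\<close>

lemma numeric_linear:
  assumes "numeric G" and "numeric H"
  shows "game_le G H \<or> game_le H G"
proof (rule disjCI)
  assume "\<not> game_le H G"
  then consider G' where "G' |\<in>| right_opts G" "game_le G' H"
    | H' where "H' |\<in>| left_opts H" "game_le G H'"
    using game_le_iff[of H G] by auto
  then show "game_le G H"
    by cases (meson assms numeric_left numeric_right game_le_trans)+
qed

lemma uminus_zero_game: "- (0 :: game) = 0"
  by (simp add: zero_game_def)

lemma numeric_zero: "numeric 0"
  by (rule numeric.intros) (auto simp: zero_game_def)

lemma numeric_uminus: "numeric G \<Longrightarrow> numeric (- G)"
proof (induction rule: numeric.induct)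
  case (1 G)
  show ?case
    using 1 options_of_uminus[of Left G] options_of_uminus[of Right G]
    by (intro numeric.intros) (auto intro: game_le_uminus)
qed

text \<open>For a number, failing to be \<open>\<le> 0\<close> means being \<open>> 0\<close>, by
  \<open>numeric_linear\<close>.\<close>

definition positive :: "game \<Rightarrow> bool" where
  "positive x \<longleftrightarrow> numeric x \<and> \<not> game_le x 0"

lemma positive_le: "positive x \<Longrightarrow> numeric y \<Longrightarrow> game_le x y \<Longrightarrow> positive y"
  unfolding positive_def using game_le_trans by blast

lemma positive_right: "positive x \<Longrightarrow> x' |\<in>| right_opts x \<Longrightarrow> positive x'"
  by (meson numeric_right positive_le positive_def)

text \<open>\<open>0\<close> has no Right options, so \<open>x \<le> 0\<close> can fail only through
  a Left option of \<open>x\<close>. Moving there leaves a Flower at least as good for Left as its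
  bare stem.\<close>

lemma positive_left_option:
  assumes "positive x" obtains x' where "x' |\<in>| left_opts x" and "game_le 0 x'"
  using assms game_le_iff[of x 0] by (auto simp: positive_def zero_game_def)

section \<open>Nim\<close>

text \<open>The recursion builds the set of smaller heaps rather than the heap, because this set is
  both the option set of a heap and the base under a Blossom in \<open>flower\<close>.\<close>

primrec heaps_below :: "nat \<Rightarrow> game fset" where
  "heaps_below 0 = {||}"
| "heaps_below (Suc h) = finsert (Game (heaps_below h) (heaps_below h)) (heaps_below h)"

definition heap :: "nat \<Rightarrow> game" where
  "heap h = Game (heaps_below h) (heaps_below h)"

lemma in_heaps_below: "G |\<in>| heaps_below h \<longleftrightarrow> (\<exists>i<h. G = heap i)"
  by (induction h) (auto simp: heap_def less_Suc_eq)

lemma left_opts_heap [simp]: "left_opts (heap h) = heaps_below h"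
  and right_opts_heap [simp]: "right_opts (heap h) = heaps_below h"
  by (simp_all add: heap_def)

lemma in_options_heap: "G |\<in>| options_of p (heap h) \<longleftrightarrow> (\<exists>i<h. G = heap i)"
  by (cases p) (auto simp: in_heaps_below)

lemma heap_0 [simp]: "heap 0 = 0"
  by (simp add: heap_def zero_game_def)

lemma uminus_heap: "- heap h = heap h"
proof (induction h rule: less_induct)
  case (less h)
  then have "uminus |`| heaps_below h = heaps_below h"
    by (auto simp: in_heaps_below fset_eq_iff image_iff) (metis in_heaps_below)+
  then show ?case by (simp add: heap_def)
qed

abbreviation nim :: "nat multiset \<Rightarrow> game" where
  "nim S \<equiv> (\<Sum>h\<in>#S. heap h)"

lemma uminus_nim: "- nim S = nim S"
  by (induction S) (simp_all add: uminus_zero_game uminus_plus_game uminus_heap)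

text \<open>Nim equals its own negative. Hence all Nim conditions below can be stated for Left
  moving first.\<close>

lemma wins_first_nim: "wins_first c Right (nim S) \<longleftrightarrow> wins_first c Left (nim S)"
  using wins_first_uminus[of c Right "nim S"] by (simp add: uminus_nim)

lemma options_nim:
  "G |\<in>| options_of p (nim S) \<longleftrightarrow> (\<exists>i\<in>#S. \<exists>j<i. G = nim (add_mset j (S - {#i#})))"
proof (induction S arbitrary: G)
  case empty
  then show ?case by (cases p) (auto simp: zero_game_def)
next
  case (add a S)
  have *: "add_mset a S - {#i#} = add_mset a (S - {#i#})" if "i \<in># S" for i
    using that by simp
  have "G |\<in>| options_of p (nim (add_mset a S)) \<longleftrightarrow>
      (\<exists>j<a. G = heap j + nim S) \<or>
      (\<exists>G'. G' |\<in>| options_of p (nim S) \<and> G = heap a + G')"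
    by (cases p) (auto simp: in_heaps_below image_iff Bex_def)
  also have "(\<exists>G'. G' |\<in>| options_of p (nim S) \<and> G = heap a + G') \<longleftrightarrow>
      (\<exists>i\<in>#S. \<exists>j<i. G = nim (add_mset j (add_mset a S - {#i#})))"
    unfolding add.IH by (fastforce simp: * add.left_commute)
  also have "(\<exists>j<a. G = heap j + nim S) \<longleftrightarrow>
      (\<exists>j<a. G = nim (add_mset j (add_mset a S - {#a#})))"
    by simp
  finally show ?case
    by (simp only: set_mset_add_mset_insert insert_iff Bex_def ex_disj_distrib conj_disj_distribR simp_thms)
qed

lemma option_nim: "i \<in># S \<Longrightarrow> j < i \<Longrightarrow> nim (add_mset j (S - {#i#})) |\<in>| options_of p (nim S)"
  by (auto simp: options_nim)

text \<open>All moves are forced up to equality of positions, so only the parity of the number of heaps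
  of size \<open>1\<close> matters.\<close>

lemma wins_first_small_nim:
  assumes "\<forall>h\<in>#S. h \<le> 1"
  shows "wins_first c p (nim S) \<longleftrightarrow> (odd (\<Sum>\<^sub># S) \<longleftrightarrow> c = Normal)"
  using assms
proof (induction "\<Sum>\<^sub># S" arbitrary: S p)
  case 0
  then have "options_of p (nim S) = {||}"
    by (auto simp: fset_eq_iff options_nim)
  moreover have "even (\<Sum>\<^sub># S)" by (subst 0(1)[symmetric]) simp
  ultimately show ?case by (subst wins_first.simps) (cases c; simp)
next
  case (Suc m)
  have opt: "\<exists>S'. \<Sum>\<^sub># S' = m \<and> (\<forall>h\<in>#S'. h \<le> 1) \<and> G = nim S'"
    if G: "G |\<in>| options_of p (nim S)" for G
  proof -
    obtain i j where ij: "i \<in># S" "j < i" "G = nim (add_mset j (S - {#i#}))"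
      using iffD1[OF options_nim G] by (elim bexE exE conjE) (rule that)
    then have "i = 1" "j = 0" using Suc.prems by force+
    have "\<Sum>\<^sub># S = i + \<Sum>\<^sub># (S - {#i#})"
      by (rule sum_mset.remove[OF ij(1)])
    with \<open>i = 1\<close> have "\<Sum>\<^sub># (add_mset j (S - {#i#})) = m"
      using Suc.hyps(2) \<open>j = 0\<close> by simp
    moreover have "\<forall>h\<in>#add_mset j (S - {#i#}). h \<le> 1"
      using Suc.prems \<open>j = 0\<close> in_diffD by fastforce
    ultimately show ?thesis using ij(3) by blast
  qed
  obtain i where "i \<in># S" "i \<noteq> 0" using Suc.hyps(2) by (metis nat.distinct(1) sum_mset_0_iff)
  then have ne: "options_of p (nim S) \<noteq> {||}" using option_nim[of i S 0 p] by auto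
  have "wins_first c (opponent p) G \<longleftrightarrow> (odd m \<longleftrightarrow> c = Normal)"
    if G: "G |\<in>| options_of p (nim S)" for G
    using opt[OF G] Suc.hyps(1) by blast
  then have "wins_first c p (nim S) \<longleftrightarrow> \<not> (odd m \<longleftrightarrow> c = Normal)"
    using ne by (subst wins_first.simps) auto
  then show ?case using Suc.hyps(2) by (metis even_Suc)
qed

text \<open>If \<open>h\<close> is the only heap of size at least \<open>2\<close>, the mover wins
  under both conventions by reducing it to \<open>0\<close> or \<open>1\<close>, whichever gives the
  right parity. Otherwise every move leaves such a heap, and induction applies.\<close>

lemma wins_first_big_nim:
  assumes "h \<in># S" and "2 \<le> h"
  shows "wins_first c Left (nim S) \<longleftrightarrow> wins_first Normal Left (nim S)"
  using assms
proof (induction "\<Sum>\<^sub># S" arbitrary: S h rule: less_induct)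
  case less
  have opt: "\<exists>S'. \<Sum>\<^sub># S' < \<Sum>\<^sub># S \<and> G = nim S'"
    if G: "G |\<in>| options_of p (nim S)" for G p
  proof -
    obtain i j where ij: "i \<in># S" "j < i" "G = nim (add_mset j (S - {#i#}))"
      using iffD1[OF options_nim G] by (elim bexE exE conjE) (rule that)
    moreover have "\<Sum>\<^sub># S = i + \<Sum>\<^sub># (S - {#i#})" by (rule sum_mset.remove[OF ij(1)])
    ultimately show ?thesis by (intro exI[of _ "add_mset j (S - {#i#})"]) auto
  qed
  define T where "T = S - {#h#}"
  have S: "S = add_mset h T" using less.prems by (simp add: T_def)
  show ?case
  proof (cases "\<forall>i\<in>#T. i \<le> 1")
    case True
    have "wins_first d Left (nim S)" for d
    proof -
      have o: "nim (add_mset j T) |\<in>| options_of Left (nim S)" if "j < 2" for j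
        using option_nim[of h S j Left] that less.prems by (simp add: T_def)
      have "\<exists>j<2. \<not> wins_first d Right (nim (add_mset j T))"
      proof (cases "odd (\<Sum>\<^sub># T) \<longleftrightarrow> d = Normal")
        case True
        then show ?thesis
          using wins_first_small_nim[of "add_mset 1 T" d Right] \<open>\<forall>i\<in>#T. i \<le> 1\<close>
          by (intro exI[of _ 1]) auto
      next
        case False
        then show ?thesis
          using wins_first_small_nim[of "add_mset 0 T" d Right] \<open>\<forall>i\<in>#T. i \<le> 1\<close>
          by (intro exI[of _ 0]) auto
      qed
      then show ?thesis using o by (metis opponent.simps(1) wins_firstI)
    qed
    then show ?thesis by simp
  next
    case False
    then obtain i where i: "i \<in># T" "2 \<le> i" by force
    have "wins_first c Right G \<longleftrightarrow> wins_first Normal Right G"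
      if G: "G |\<in>| options_of Left (nim S)" for G
    proof -
      obtain k j where kj: "k \<in># S" "j < k" "G = nim (add_mset j (S - {#k#}))"
        using iffD1[OF options_nim G] by (elim bexE exE conjE) (rule that)
      have "\<exists>b\<in>#S - {#k#}. 2 \<le> b"
        using i less.prems(2) kj(1) unfolding S
        by (cases "k = h") (auto intro: bexI[of _ h])
      then obtain b where b: "b \<in># S - {#k#}" "2 \<le> b" by blast
      have "\<Sum>\<^sub># S = k + \<Sum>\<^sub># (S - {#k#})" by (rule sum_mset.remove[OF kj(1)])
      then show ?thesis
        using less.hyps[of "add_mset j (S - {#k#})" b] b kj(2) unfolding kj(3) wins_first_nim by auto
    qed
    moreover have "options_of Left (nim S) \<noteq> {||}"
      using option_nim[of h S 0 Left] less.prems by auto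
    ultimately show ?thesis by (subst (1 2) wins_first.simps) auto
  qed
qed

text \<open>A heap is its own negative, so \<open>heap j + heap j\<close> is a difference of equal
  games and has normal-play value \<open>0\<close>.\<close>

lemma double_heap_cancel:
  "wins_first Normal Left (heap j + (heap j + G)) \<longleftrightarrow> wins_first Normal Left G"
proof -
  have "\<not> wins_first Normal Right (heap j + heap j)"
    using left_survives_refl[of "heap j"] by (simp add: left_survives_def uminus_heap)
  moreover have "wins_first Normal Left (heap j + heap j) \<longleftrightarrow> wins_first Normal Right (heap j + heap j)"
    using wins_first_nim[of Normal "{#j, j#}"] by simp
  moreover have "wins_first Normal Left (- (heap j + heap j)) \<longleftrightarrow> wins_first Normal Right (heap j + heap j)"
    by (simp add: wins_first_uminus)
  ultimately have "game_le (heap j + heap j) 0" "game_le 0 (heap j + heap j)"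
    unfolding game_le_iff_left_survives left_survives_def
    by (simp_all add: uminus_plus_game uminus_heap uminus_zero_game)
  then show ?thesis
    unfolding game_le_def by (metis add.assoc add_0)
qed

text \<open>Under misere play, pairs of equal heaps cancel only in the presence of a heap of size at
  least \<open>2\<close>; if none is left, \<open>{i, j} = {0, 1}\<close> adjusts the parity.\<close>

lemma double_heap_losing:
  assumes "\<not> wins_first c Left (nim (add_mset h (add_mset h S)))" and "2 \<le> h" and "j < h"
  shows "\<exists>i<h. \<not> wins_first c Left (nim (add_mset i (add_mset j S)))"
proof -
  have "\<not> wins_first Normal Left (nim S)"
    using assms(1) wins_first_big_nim[of h "add_mset h (add_mset h S)" c] assms(2)
    by (simp add: double_heap_cancel)
  then have N: "\<not> wins_first Normal Left (nim (add_mset j (add_mset j S)))"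
    by (simp add: double_heap_cancel)
  show ?thesis
  proof (cases "c = Normal \<or> (\<exists>i\<in>#add_mset j (add_mset j S). 2 \<le> i)")
    case True
    then show ?thesis using N wins_first_big_nim assms(3) by metis
  next
    case False
    then have c: "c = Misere" and j: "j \<le> 1" and S: "\<forall>i\<in>#S. i \<le> 1"
      by (cases c; force)+
    have "even (\<Sum>\<^sub># S)"
      using N wins_first_small_nim[of "add_mset j (add_mset j S)" Normal Left] j S by auto
    then have "\<not> wins_first c Left (nim (add_mset (1 - j) (add_mset j S)))"
      using wins_first_small_nim[of "add_mset (1 - j) (add_mset j S)" c Left] j S c by auto
    then show ?thesis using assms(2) by (intro exI[of _ "1 - j"]) auto
  qed
qed

text \<open>Either \<open>{#h, h#}\<close> is losing, or its winning move reduces one of the two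
  heaps to the required \<open>j\<close>.\<close>

lemma ex_nim_losing_pair:
  assumes "1 \<le> h"
  shows "\<exists>j\<le>h. \<not> wins_first c Left (nim {#h, j#})"
proof (rule ccontr)
  assume *: "\<not> ?thesis"
  then have "wins_first c Left (nim {#h, h#})" by blast
  moreover have "options_of Left (nim {#h, h#}) \<noteq> {||}"
    using option_nim[of h "{#h, h#}" 0 Left] assms by auto
  ultimately obtain G where "G |\<in>| options_of Left (nim {#h, h#})"
    and G: "\<not> wins_first c (opponent Left) G"
    by (rule wins_firstE[OF _ disjI2])
  then obtain i j where "i \<in># {#h, h#}" "j < i" "G = nim (add_mset j ({#h, h#} - {#i#}))"
    unfolding options_nim by blast
  then have "j < h" "\<not> wins_first c Right (nim {#j, h#})"
    using G by auto
  moreover have "nim {#j, h#} = nim {#h, j#}" by (simp add: add.commute)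
  ultimately show False using * unfolding wins_first_nim by (metis less_imp_le)
qed

text \<open>For each \<open>i\<close> at most one \<open>j\<close> makes the position losing, so the \<open>h\<close> values of \<open>i\<close>
  cannot spoil all \<open>h + 1\<close> values of \<open>j\<close>.\<close>

lemma ex_nim_avoiding_heap:
  "\<exists>j\<le>h. \<forall>i<h. wins_first c Left (nim (add_mset i (add_mset j S)))"
proof (rule ccontr)
  assume "\<not> ?thesis"
  then obtain f where f: "\<And>j. j \<le> h \<Longrightarrow> f j < h \<and>
      \<not> wins_first c Left (nim (add_mset (f j) (add_mset j S)))"
    by metis
  have lt: "wins_first c Left (nim (add_mset i (add_mset j S)))"
    if "\<not> wins_first c Left (nim (add_mset i (add_mset j' S)))" "j' < j" for i j j'
    using that option_nim[of j "add_mset i (add_mset j S)" j' Left]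
    by (intro wins_firstI[of "nim (add_mset i (add_mset j' S))"])
      (auto simp: wins_first_nim[of c "add_mset i (add_mset j' S)", simplified] add_mset_commute add.left_commute)
  have "inj_on f {..h}"
    by (rule inj_onI) (metis f lt atMost_iff linorder_neqE_nat)
  moreover have "f ` {..h} \<subseteq> {..<h}" using f by auto
  ultimately have "card {..h} \<le> card {..<h}" by (intro card_inj_on_le) auto
  then show False by simp
qed

lemma nim_eq_zero:
  assumes "options_of p (nim S) = {||}" shows "nim S = 0"
proof (rule game_eqI)
  fix q G
  have "G |\<notin>| options_of q (nim S)" using assms unfolding fset_eq_iff options_nim by simp
  moreover have "G |\<notin>| options_of q 0" by (cases q) (simp_all add: zero_game_def)
  ultimately show "G |\<in>| options_of q (nim S) \<longleftrightarrow> G |\<in>| options_of q 0" by blast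
qed

section \<open>Flowers\<close>

text \<open>Cutting the stem anywhere discards the Blossom, so a Flower is an ordinal sum over the
  heap \<open>h\<close>; \<open>game_of_flower_position\<close> confirms this for the graph.\<close>

definition flower :: "nat \<Rightarrow> game \<Rightarrow> game" where
  "flower h x = above (heaps_below h) x"

lemma in_options_flower:
  "G |\<in>| options_of p (flower h x) \<longleftrightarrow>
     (\<exists>i<h. G = heap i) \<or> (\<exists>x'. x' |\<in>| options_of p x \<and> G = flower h x')"
  by (cases p) (auto simp: flower_def in_heaps_below)

lemma flower_zero: "flower h 0 = heap h"
  by (rule game_eqI) (auto simp: in_options_flower in_options_heap zero_game_def; (case_tac p; simp))

lemma stem_option: "i < h \<Longrightarrow> heap i + G |\<in>| options_of p (flower h x + G)"
  by (rule options_plusI(1)) (auto simp only: in_options_flower)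

lemma blossom_option:
  "x' |\<in>| options_of p x \<Longrightarrow> flower h x' + G |\<in>| options_of p (flower h x + G)"
  by (rule options_plusI(1)) (auto simp only: in_options_flower)

lemma options_flower_plus_nonempty: "1 \<le> h \<Longrightarrow> options_of p (flower h x + G) \<noteq> {||}"
  using stem_option[of 0 h G p x] by force

lemma flower_plus_optionE:
  assumes "K |\<in>| options_of p (flower h x + G)"
  obtains (stem) i where "i < h" "K = heap i + G"
    | (blossom) x' where "x' |\<in>| options_of p x" "K = flower h x' + G"
    | (rest) G' where "G' |\<in>| options_of p G" "K = flower h x + G'"
  using assms unfolding in_options_plus in_options_flower by blast

text \<open>The colon principle for Flowers; \<open>1 \<le> h\<close> makes the base nonempty, as
  misere play demands.\<close>

lemma wins_first_flower_mono:
  assumes "1 \<le> h" and "game_le x y"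
  shows "wins_first c Left (flower h x + G) \<Longrightarrow> wins_first c Left (flower h y + G)"
    and "\<not> wins_first c Right (flower h x + G) \<Longrightarrow> \<not> wins_first c Right (flower h y + G)"
proof -
  have "heaps_below h \<noteq> {||}" using assms(1) by (cases h) auto
  note mono = wins_first_above_mono[OF this assms(2), of c G, folded flower_def]
  show "wins_first c Left (flower h x + G) \<Longrightarrow> wins_first c Left (flower h y + G)"
    by (rule mono(1))
  show "\<not> wins_first c Right (flower h x + G) \<Longrightarrow> \<not> wins_first c Right (flower h y + G)"
    by (rule mono(2))
qed

section \<open>One or two positive Flowers with Nim\<close>

lemma nim_option_nim:
  assumes "G |\<in>| options_of p (nim S)" obtains S' where "G = nim S'"
  using assms that by (auto simp only: options_nim)

lemma losing_nim_smaller_heap: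
  assumes "\<not> wins_first c Left (nim (add_mset h S))" and "i < h"
  shows "wins_first c Left (nim (add_mset i S))"
proof -
  have "heap i + nim S |\<in>| options_of Left (heap h + nim S)"
    using assms(2) by (intro options_plusI(1)) (auto simp only: in_options_heap)
  then have "nim (add_mset i S) |\<in>| options_of Left (nim (add_mset h S))" by simp
  then show ?thesis
    using not_wins_firstD[OF assms(1)] wins_first_nim[of c "add_mset i S"] by simp
qed

text \<open>Both claims go by one induction. In the second, stem cuts are covered by its hypothesis,
  and every other Right move leaves a positive Flower with Left to move.\<close>

lemma lone_positive_flower:
  assumes "1 \<le> h" and "positive x"
  shows "wins_first c Left (flower h x + nim S) \<and>
    ((\<forall>i<h. wins_first c Left (nim (add_mset i S))) \<longrightarrow>
      \<not> wins_first c Right (flower h x + nim S))"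
  using assms(2)
proof (induction "size (flower h x + nim S)" arbitrary: x S rule: less_induct)
  case less
  have IH: "wins_first c Left (flower h x' + nim S')"
    "(\<forall>i<h. wins_first c Left (nim (add_mset i S'))) \<Longrightarrow>
      \<not> wins_first c Right (flower h x' + nim S')"
    if "flower h x' + nim S' |\<in>| options_of p (flower h x + nim S)" "positive x'" for x' S' p
    using less.hyps[of x' S'] size_options_of[OF that(1)] that(2) by auto
  have "wins_first c Left (flower h x + nim S)"
  proof -
    consider (stem) i where "i < h" "\<not> wins_first c Left (nim (add_mset i S))"
      | (blossom) "\<not> wins_first c Left (nim (add_mset h S))"
      | (rest) "\<forall>i<h. wins_first c Left (nim (add_mset i S))"
          "wins_first c Left (nim (add_mset h S))"
      by blast
    then show ?thesis
    proof cases
      case stem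
      then show ?thesis
        using wins_first_LeftI[OF stem_option[OF stem(1)]] wins_first_nim[of c "add_mset i S"] by simp
    next
      \<comment> \<open>A move to \<open>x' \<ge> 0\<close> leaves a Flower at least as good for
        Left as the Stalk \<open>h\<close>, which together with \<open>S\<close> is losing for Right
        to move.\<close>
      case blossom
      obtain x' where x': "x' |\<in>| left_opts x" "game_le 0 x'"
        using positive_left_option less.prems by blast
      have "\<not> wins_first c Right (flower h 0 + nim S)"
        using blossom wins_first_nim[of c "add_mset h S"] by (simp add: flower_zero)
      then have "\<not> wins_first c Right (flower h x' + nim S)"
        using wins_first_flower_mono(2) assms(1) x'(2) by blast
      then show ?thesis
        using wins_first_LeftI[OF blossom_option[of x' Left x]] x'(1) by simp
    next
      \<comment> \<open>Left follows a winning Nim move for \<open>h\<close> and \<open>S\<close>.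
        It cannot reduce the heap \<open>h\<close>, so it leads to an \<open>S'\<close> with which
        \<open>h\<close> is losing. Then all smaller heaps are winning with \<open>S'\<close>, and
        the second claim applies.\<close>
      case rest
      have "options_of Left (heap h + nim S) \<noteq> {||}"
        using options_flower_plus_nonempty[OF assms(1), of Left 0] by (simp only: flower_zero) simp
      moreover have "wins_first c Left (heap h + nim S)" using rest(2) by simp
      ultimately obtain K where K: "K |\<in>| options_of Left (heap h + nim S)"
          "\<not> wins_first c Right K"
        by (meson wins_first_LeftE)
      from K(1) consider i where "i < h" "K = heap i + nim S"
        | G' where "G' |\<in>| options_of Left (nim S)" "K = heap h + G'"
        unfolding in_options_plus in_options_heap by blast
      then show ?thesis
      proof cases
        case 1
        then show ?thesis using rest(1) K(2) wins_first_nim[of c "add_mset i S"] by simp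
      next
        case 2
        then obtain S' where S': "G' = nim S'" using nim_option_nim by blast
        then have "\<not> wins_first c Left (nim (add_mset h S'))"
          using K(2) 2 wins_first_nim[of c "add_mset h S'"] by simp
        then have "\<forall>i<h. wins_first c Left (nim (add_mset i S'))"
          using losing_nim_smaller_heap by blast
        moreover have o: "flower h x + nim S' |\<in>| options_of Left (flower h x + nim S)"
          using 2 S' by (intro options_plusI(2)) simp
        ultimately show ?thesis
          using wins_first_LeftI[OF o] IH(2)[OF o less.prems] by blast
      qed
    qed
  qed
  moreover have "\<not> wins_first c Right (flower h x + nim S)"
    if all: "\<forall>i<h. wins_first c Left (nim (add_mset i S))"
  proof (rule not_wins_firstI)
    fix K assume K: "K |\<in>| options_of Right (flower h x + nim S)"
    then show "wins_first c (opponent Right) K"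
    proof (cases rule: flower_plus_optionE)
      case (stem i)
      then show ?thesis using all by simp
    next
      case (blossom x')
      then show ?thesis
        using IH(1)[OF K[unfolded blossom(2)]] positive_right[OF less.prems] by simp
    next
      case (rest G')
      then obtain S' where S': "K = flower h x + nim S'" using nim_option_nim by blast
      then show ?thesis using IH(1)[OF K[unfolded S'] less.prems] by simp
    qed
  qed (use options_flower_plus_nonempty assms(1) in blast)
  ultimately show ?case by blast
qed

text \<open>If \<open>{#h, j#}\<close> is losing, every \<open>i < h\<close> makes
  \<open>{#i, j#}\<close> winning, so Left moving second wins \<open>flower h x\<close> beside a
  Stalk \<open>j\<close>. Left cuts the stem \<open>k\<close> to \<open>j\<close>; if
  \<open>j = k\<close>, a Blossom move to \<open>z' \<ge> 0\<close> does at least as well.\<close>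

lemma two_positive_flowers:
  assumes "1 \<le> h" "h \<le> k" and "positive x" "positive z"
  shows "wins_first c Left (flower h x + flower k z)"
proof -
  obtain j where j: "j \<le> h" "\<not> wins_first c Left (nim {#h, j#})"
    using ex_nim_losing_pair[OF assms(1)] by blast
  then have "\<forall>i<h. wins_first c Left (nim {#i, j#})"
    using losing_nim_smaller_heap by blast
  then have win: "\<not> wins_first c Right (heap j + flower h x)"
    using lone_positive_flower[OF assms(1,3), of c "{#j#}"] by (simp add: add.commute)
  show ?thesis
  proof (cases "j < k")
    case True
    then have "wins_first c Left (flower k z + flower h x)"
      using wins_first_LeftI[OF stem_option win] by blast
    then show ?thesis by (simp add: add.commute)
  next
    case False
    then have "j = k" using j(1) assms(2) by simp
    obtain z' where z': "z' |\<in>| left_opts z" "game_le 0 z'"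
      using positive_left_option assms(4) by blast
    have "\<not> wins_first c Right (flower k z' + flower h x)"
      using wins_first_flower_mono(2)[of k 0 z' c "flower h x"] win z'(2) assms \<open>j = k\<close>
      by (simp add: flower_zero)
    then have "wins_first c Left (flower k z + flower h x)"
      using wins_first_LeftI[OF blossom_option] z'(1) by (metis options_of.simps(1))
    then show ?thesis by (simp add: add.commute)
  qed
qed

section \<open>Flowerbeds measured by their advantage\<close>

text \<open>The red Flower of reference has height \<open>k\<close> and blossom \<open>- z\<close>.\<close>

definition outranks :: "nat \<Rightarrow> game \<Rightarrow> nat \<Rightarrow> game \<Rightarrow> bool" where
  "outranks k z h x \<longleftrightarrow> 1 \<le> h \<and> positive x \<and> (h < k \<or> h = k \<and> \<not> game_le x z)"

lemma outranks_right: "outranks k z h x \<Longrightarrow> x' |\<in>| right_opts x \<Longrightarrow> outranks k z h x'"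
  unfolding outranks_def
  by (meson game_le_trans numeric_right(2) positive_def positive_right)

text \<open>The \<open>r\<close> flowers of the last rule have arbitrary numbers as blossoms, because Right's moves may
  change the sign of the value of a red Blossom.\<close>

inductive bed :: "nat \<Rightarrow> game \<Rightarrow> nat \<Rightarrow> nat \<Rightarrow> game \<Rightarrow> bool" for k z where
  stalks: "bed k z 0 0 (nim S)"
| blue: "outranks k z h x \<Longrightarrow> bed k z b r G \<Longrightarrow> bed k z (Suc b) r (flower h x + G)"
| other: "1 \<le> h \<Longrightarrow> numeric x \<Longrightarrow> bed k z b r G \<Longrightarrow> bed k z b (Suc r) (flower h x + G)"

lemma bed_add_heap: "bed k z b r G \<Longrightarrow> bed k z b r (heap i + G)"
proof (induction rule: bed.induct)
  case (stalks S)
  show ?case using bed.stalks[of k z "add_mset i S"] by simp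
next
  case (blue h x b r G)
  show ?case using bed.blue[OF blue.hyps(1) blue.IH] by (simp add: add.left_commute)
next
  case (other h x b r G)
  show ?case using bed.other[OF other.hyps(1,2) other.IH] by (simp add: add.left_commute)
qed

lemma bed_stalks: "bed k z 0 0 G \<Longrightarrow> \<exists>S. G = nim S"
  by (auto elim: bed.cases)

lemma bed_split_blue:
  assumes "bed k z (Suc b) r G"
  obtains h x G' where "outranks k z h x" "bed k z b r G'" "G = flower h x + G'"
proof -
  have "bed k z c r G \<Longrightarrow> c = Suc b \<Longrightarrow>
    \<exists>h x G'. outranks k z h x \<and> bed k z b r G' \<and> G = flower h x + G'" for c
  proof (induction arbitrary: b rule: bed.induct)
    case (other h x c r G)
    then show ?case by (metis add.left_commute bed.other)
  qed auto
  then show thesis using assms that by blast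
qed

lemma bed_split_other:
  assumes "bed k z b (Suc r) G"
  obtains h x G' where "1 \<le> h" "numeric x" "bed k z b r G'" "G = flower h x + G'"
proof -
  have "bed k z b s G \<Longrightarrow> s = Suc r \<Longrightarrow>
    \<exists>h x G'. 1 \<le> h \<and> numeric x \<and> bed k z b r G' \<and> G = flower h x + G'" for s
  proof (induction arbitrary: r rule: bed.induct)
    case (blue h x b s G)
    then show ?case by (metis add.left_commute bed.blue)
  qed auto
  then show thesis using assms that by blast
qed

text \<open>The advantage \<open>b - r\<close> drops by at most one, written without subtraction.
  Only a stem cut in a counted blue Flower lowers it, since Right's Blossom moves preserve
  \<open>outranks\<close> and \<open>numeric\<close>.\<close>

lemma bed_right_option:
  assumes "bed k z b r G" and "G' |\<in>| options_of Right G"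
  shows "\<exists>b' r'. bed k z b' r' G' \<and> b + r' \<le> Suc (b' + r)"
  using assms
proof (induction arbitrary: G' rule: bed.induct)
  case (stalks S)
  then obtain S' where "G' = nim S'" using nim_option_nim by blast
  then show ?case using bed.stalks by (intro exI[of _ 0]) simp
next
  case (blue h x b r G)
  from blue.prems show ?case
  proof (cases rule: flower_plus_optionE)
    case (stem i)
    then show ?thesis using bed_add_heap[OF blue.hyps(2)] by (intro exI[of _ b] exI[of _ r]) simp
  next
    case (blossom x')
    then show ?thesis using outranks_right[OF blue.hyps(1)] bed.blue[OF _ blue.hyps(2)]
      by (intro exI[of _ "Suc b"] exI[of _ r]) simp
  next
    case (rest H)
    then obtain b' r' where "bed k z b' r' H" "b + r' \<le> Suc (b' + r)" using blue.IH by blast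
    then show ?thesis using rest bed.blue[OF blue.hyps(1)]
      by (intro exI[of _ "Suc b'"] exI[of _ r']) simp
  qed
next
  case (other h x b r G)
  from other.prems show ?case
  proof (cases rule: flower_plus_optionE)
    case (stem i)
    then show ?thesis using bed_add_heap[OF other.hyps(3)] by (intro exI[of _ b] exI[of _ r]) simp
  next
    case (blossom x')
    then show ?thesis using numeric_right(1)[OF other.hyps(2)] bed.other[OF other.hyps(1) _ other.hyps(3)]
      by (intro exI[of _ b] exI[of _ "Suc r"]) simp
  next
    case (rest H)
    then obtain b' r' where "bed k z b' r' H" "b + r' \<le> Suc (b' + r)" using other.IH by blast
    then show ?thesis using rest bed.other[OF other.hyps(1,2)]
      by (intro exI[of _ b'] exI[of _ "Suc r'"]) simp
  qed
qed

text \<open>The second clause follows from the first, as Right lowers the advantage by at most one.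
  For the first, Left cuts one of the \<open>r\<close> Flowers at the ground if there is any;
  otherwise one, two and more blue Flowers are treated separately.\<close>

lemma bed_advantage:
  assumes "bed k z b r G"
  shows "(r + 1 \<le> b \<longrightarrow> wins_first c Left G) \<and> (r + 2 \<le> b \<longrightarrow> \<not> wins_first c Right G)"
  using assms
proof (induction "size G" arbitrary: b r G rule: less_induct)
  case less
  have IH: "r' + 1 \<le> b' \<Longrightarrow> wins_first c Left G'" "r' + 2 \<le> b' \<Longrightarrow> \<not> wins_first c Right G'"
    if "bed k z b' r' G'" "G' |\<in>| options_of p G" for b' r' G' p
    using less.hyps[OF size_options_of that(1)] that(2) by blast+
  have "wins_first c Left G" if lt: "r + 1 \<le> b"
  proof (cases r)
    case (Suc r')
    then obtain h x G' where G': "1 \<le> h" "bed k z b r' G'" "G = flower h x + G'"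
      using bed_split_other less.prems by metis
    then have o: "G' |\<in>| options_of Left G" using stem_option[of 0 h G' Left x] by simp
    then show ?thesis using wins_first_LeftI[OF o] IH(2)[OF G'(2) o] lt Suc by simp
  next
    case 0
    obtain b' where b': "b = Suc b'" using lt by (cases b) auto
    then obtain h x G' where G': "outranks k z h x" "bed k z b' 0 G'" "G = flower h x + G'"
      using bed_split_blue less.prems 0 by metis
    consider "b' = 0" | "b' = 1" | "2 \<le> b'" by linarith
    then show ?thesis
    proof cases
      case 1
      then obtain S where "G' = nim S" using bed_stalks G'(2) by blast
      then show ?thesis
        using lone_positive_flower[of h x c S] G'(1,3) by (simp add: outranks_def)
    next
      case 2
      then obtain h' x' G'' where G'': "outranks k z h' x'" "bed k z 0 0 G''" "G' = flower h' x' + G''"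
        using bed_split_blue G'(2) by (metis One_nat_def)
      obtain S where S: "G'' = nim S" using bed_stalks G''(2) by blast
      show ?thesis
      proof (cases "options_of Left G'' = {||}")
        case True
        then have "G'' = 0" unfolding S by (rule nim_eq_zero)
        then have "G = flower h x + flower h' x'" using G' G'' by simp
        then show ?thesis
          using two_positive_flowers[of h h' x x' c] two_positive_flowers[of h' h x' x c] G'(1) G''(1)
          by (cases "h \<le> h'") (auto simp: outranks_def add.commute)
      next
        \<comment> \<open>A move in a Stalk passes the turn while the advantage stays
          \<open>2\<close>.\<close>
        case False
        then obtain K where K: "K |\<in>| options_of Left G''" by blast
        then obtain S' where S': "K = nim S'" unfolding S using nim_option_nim by blast
        have "bed k z 2 0 (flower h x + (flower h' x' + K))"
          using bed.blue[OF G'(1) bed.blue[OF G''(1) bed.stalks]] unfolding S' numeral_2_eq_2 .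
        moreover have o: "flower h x + (flower h' x' + K) |\<in>| options_of Left G"
          unfolding G'(3) G''(3) by (intro options_plusI K)
        ultimately show ?thesis using wins_first_LeftI[OF o] IH(2)[OF _ o] by simp
      qed
    next
      \<comment> \<open>With only blue Flowers left, Left sacrifices one; an advantage of at least
        \<open>2\<close> remains.\<close>
      case 3
      have o: "G' |\<in>| options_of Left G"
        using stem_option[of 0 h G' Left x] G'(1,3) by (simp add: outranks_def)
      then show ?thesis using wins_first_LeftI[OF o] IH(2)[OF G'(2) o] 3 by simp
    qed
  qed
  moreover have "\<not> wins_first c Right G" if lt: "r + 2 \<le> b"
  proof (rule not_wins_firstI)
    obtain b' where "b = Suc b'" using lt by (cases b) auto
    then obtain h x G' where "outranks k z h x" "G = flower h x + G'"
      using bed_split_blue less.prems by metis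
    then show "c = Normal \<or> options_of Right G \<noteq> {||}"
      using options_flower_plus_nonempty unfolding outranks_def by blast
    fix G' assume o: "G' |\<in>| options_of Right G"
    then obtain b' r' where "bed k z b' r' G'" "b + r' \<le> Suc (b' + r)"
      using bed_right_option less.prems by blast
    then show "wins_first c (opponent Right) G'" using IH(1)[OF _ o] lt by simp
  qed
  ultimately show ?case by blast
qed

text \<open>The two heaps \<open>h\<close> stand for the stems of a blue and a red Flower. A winning
  move of one heap to \<open>j\<close> leaves \<open>h\<close> and \<open>j\<close> losing, so every
  \<open>i < h\<close> in place of \<open>h\<close> is winning: the red stem should be cut to this
  \<open>j\<close>.\<close>

lemma nim_pair_step:
  assumes "1 \<le> h" and "wins_first c Left (nim (add_mset h (add_mset h S)))"
  obtains (balance) j where "j < h" "\<forall>i<h. wins_first c Left (nim (add_mset i (add_mset j S)))"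
    | (rest) S' where "nim S' |\<in>| options_of Left (nim S)"
        "\<not> wins_first c Left (nim (add_mset h (add_mset h S')))"
proof -
  have "heap 0 + (heap h + nim S) |\<in>| options_of Left (heap h + (heap h + nim S))"
    using assms(1) in_options_heap by (intro options_plusI(1)) fastforce
  then have "options_of Left (heap h + (heap h + nim S)) \<noteq> {||}" by force
  moreover have "wins_first c Left (heap h + (heap h + nim S))" using assms(2) by simp
  ultimately obtain K where K: "K |\<in>| options_of Left (heap h + (heap h + nim S))"
      "\<not> wins_first c Right K"
    by (meson wins_first_LeftE)
  from K(1) consider j where "j < h" "K = heap h + (heap j + nim S)"
    | G' where "G' |\<in>| options_of Left (nim S)" "K = heap h + (heap h + G')"
    unfolding in_options_plus in_options_heap by (metis add.left_commute)
  then show thesis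
  proof cases
    case 1
    then have "\<not> wins_first c Left (nim (add_mset h (add_mset j S)))"
      using K(2) wins_first_nim[of c "add_mset h (add_mset j S)"] by simp
    then show ?thesis using balance 1(1) losing_nim_smaller_heap by blast
  next
    case 2
    then obtain S' where S': "G' = nim S'" using nim_option_nim by blast
    then show ?thesis
      using rest[of S'] 2 K(2) wins_first_nim[of c "add_mset h (add_mset h S')"] by simp
  qed
qed

lemma left_option_uminus: "x' |\<in>| right_opts x \<Longrightarrow> - x' |\<in>| options_of Left (- x)"
  by (simp add: options_of_uminus del: options_of.simps(1))

text \<open>Left maintains \<open>z \<le> x\<close> and the losing Nim position with both stems as
  heaps. Each Right move is answered by restoring both, or leads to a position won through Nim or
  \<open>lone_positive_flower\<close>.\<close>

lemma flower_pair_right_first: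
  assumes "2 \<le> h" and "positive x" and "positive z" and "game_le z x"
    and "\<not> wins_first c Left (nim (add_mset h (add_mset h S)))"
  shows "\<not> wins_first c Right (flower h x + (flower h (- z) + nim S))"
  using assms(2-)
proof (induction "size (flower h x + (flower h (- z) + nim S))" arbitrary: x z S rule: less_induct)
  case less
  let ?G = "flower h x + (flower h (- z) + nim S)"
  note prems = less.prems
  have h: "1 \<le> h" using assms(1) by simp
  \<comment> \<open>Right's move to \<open>K\<close> and Left's answer together decrease the size,
    so the induction hypothesis applies after the round.\<close>
  have reply: "wins_first c Left K"
    if "K |\<in>| options_of Right ?G"
      and K': "flower h x' + (flower h (- z') + nim S') |\<in>| options_of Left K"
      and "positive x'" "positive z'" "game_le z' x'"
        "\<not> wins_first c Left (nim (add_mset h (add_mset h S')))"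
    for K x' z' S'
    using less.hyps[of x' z' S'] size_options_of[OF that(1)] size_options_of[OF K'] that(3-)
      wins_first_LeftI[OF K'] by simp
  show ?case
  proof (rule not_wins_firstI)
    fix K assume K: "K |\<in>| options_of Right ?G"
    then show "wins_first c (opponent Right) K"
    proof (cases rule: flower_plus_optionE)
      \<comment> \<open>The blue Flower has become a Stalk \<open>j\<close>; the red stem is cut to
        the matching \<open>i\<close>.\<close>
      case (stem j)
      then obtain i where i: "i < h" "\<not> wins_first c Left (nim (add_mset i (add_mset j S)))"
        using double_heap_losing[OF prems(4) assms(1)] by blast
      have "heap j + (heap i + nim S) |\<in>| options_of Left K"
        unfolding stem by (intro options_plusI(2) stem_option i)
      then show ?thesis
        using wins_first_LeftI i(2) wins_first_nim[of c "add_mset i (add_mset j S)"]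
        by (fastforce simp: add.left_commute)
    next
      \<comment> \<open>\<open>x' \<le> z\<close> fails, and either reason for failure is an answer:
        \<open>x''\<close> in the blue Blossom or \<open>- z'\<close> in the red one.\<close>
      case (blossom x')
      then have x': "positive x'" "x' |\<in>| right_opts x" using positive_right prems(1) by auto
      then have "\<not> game_le x' z" using game_le_iff[of z x] prems(3) by blast
      then consider x'' where "x'' |\<in>| left_opts x'" "game_le z x''"
        | z' where "z' |\<in>| right_opts z" "game_le z' x'"
        using game_le_iff[of x' z] by blast
      then show ?thesis
      proof cases
        case 1
        have "positive x''"
          using 1 positive_le prems(2) numeric_left(1) x'(1) positive_def by metis
        moreover have "flower h x'' + (flower h (- z) + nim S) |\<in>| options_of Left K"
          unfolding blossom using 1 by (intro blossom_option) simp
        ultimately show ?thesis using reply[OF K] 1 prems by simp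
      next
        case 2
        have "flower h x' + (flower h (- z') + nim S) |\<in>| options_of Left K"
          unfolding blossom using 2 left_option_uminus by (intro options_plusI(2) blossom_option) simp
        then show ?thesis using reply[OF K] 2 prems x' positive_right by simp
      qed
    next
      case (rest H)
      from rest(1) show ?thesis
      proof (cases rule: flower_plus_optionE)
        case (stem j)
        then show ?thesis
          using lone_positive_flower[OF h prems(1), of c "add_mset j S"] rest by simp
      next
        case (blossom y)
        then obtain z' where z': "z' |\<in>| left_opts z" "y = - z'"
          by (auto simp: options_of_uminus simp del: options_of.simps(2))
        show ?thesis
        proof (cases "game_le z' 0")
          \<comment> \<open>The red Blossom has become \<open>\<ge> 0\<close>. Replacing it by
            \<open>0\<close> does not help Left and leaves a lone positive Flower, with
            \<open>h\<close> as one more Stalk.\<close>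
          case True
          then have "game_le 0 y" using game_le_uminus z'(2) uminus_zero_game by metis
          moreover have "wins_first c Left (flower h 0 + (flower h x + nim S))"
            using lone_positive_flower[OF h prems(1), of c "add_mset h S"]
            by (simp add: flower_zero add.left_commute)
          ultimately have "wins_first c Left (flower h y + (flower h x + nim S))"
            using wins_first_flower_mono(1) h by blast
          then show ?thesis using rest(2) blossom(2) by (simp add: add.left_commute)
        next
          case False
          then have pz: "positive z'"
            using numeric_left(1) z'(1) prems(2) by (auto simp: positive_def)
          have "\<not> game_le x z'" using game_le_iff[of z x] prems(3) z'(1) by blast
          then consider x' where "x' |\<in>| left_opts x" "game_le z' x'"
            | z'' where "z'' |\<in>| right_opts z'" "game_le z'' x"
            using game_le_iff[of x z'] by blast
          then show ?thesis
          proof cases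
            case 1
            have "positive x'"
              using 1 positive_le pz numeric_left(1) prems(1) positive_def by metis
            moreover have "flower h x' + (flower h (- z') + nim S) |\<in>| options_of Left K"
              unfolding rest(2) blossom(2) z'(2) using 1 by (intro blossom_option) simp
            ultimately show ?thesis using reply[OF K] 1 prems pz by simp
          next
            case 2
            have "flower h x + (flower h (- z'') + nim S) |\<in>| options_of Left K"
              unfolding rest(2) blossom(2) z'(2) using 2 left_option_uminus
              by (intro options_plusI(2) blossom_option) simp
            then show ?thesis using reply[OF K] 2 prems pz positive_right by simp
          qed
        qed
      next
        case (rest N)
        then obtain T where T: "N = nim T" using nim_option_nim by blast
        have KT: "K = flower h x + (flower h (- z) + nim T)"
          using rest \<open>K = flower h x + H\<close> T by simp
        have "heap h + (heap h + nim T) |\<in>| options_of Left (heap h + (heap h + nim S))"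
          using rest(1) T options_nim[of N Left S] options_nim[of N Right S]
          by (intro options_plusI(2)) blast
        then have *: "wins_first c Left (nim (add_mset h (add_mset h T)))"
          using not_wins_firstD[OF prems(4)] wins_first_nim[of c "add_mset h (add_mset h T)"] by simp
        \<comment> \<open>Right's Stalk move has made the Nim position winning. Left either cuts the
          red stem, leaving a lone Flower won by moving second, or makes the Nim position losing
          again by a Stalk move.\<close>
        show ?thesis
        proof (cases rule: nim_pair_step[OF h *])
          case (1 j)
          then have "\<not> wins_first c Right (flower h x + (heap j + nim T))"
            using lone_positive_flower[OF h prems(1), of c "add_mset j T"] by simp
          moreover have "flower h x + (heap j + nim T) |\<in>| options_of Left K"
            unfolding KT by (intro options_plusI(2) stem_option 1)
          ultimately show ?thesis using wins_first_LeftI by simp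
        next
          case (2 S')
          have "flower h x + (flower h (- z) + nim S') |\<in>| options_of Left K"
            unfolding KT by (intro options_plusI(2) 2)
          then show ?thesis using reply[OF K] 2 prems by simp
        qed
      qed
    qed
  qed (use options_flower_plus_nonempty h in blast)
qed

lemma flower_pair_left_first:
  assumes "2 \<le> k" and "positive z" and "outranks k z h x"
  shows "wins_first c Left (flower h x + (flower k (- z) + nim S))"
proof -
  have x: "1 \<le> h" "positive x" using assms(3) by (auto simp: outranks_def)
  have cut: ?thesis if "j < k" "\<forall>i<h. wins_first c Left (nim (add_mset i (add_mset j S)))" for j
  proof -
    have "\<not> wins_first c Right (flower h x + (heap j + nim S))"
      using lone_positive_flower[OF x, of c "add_mset j S"] that(2) by simp
    moreover have "flower h x + (heap j + nim S) |\<in>| options_of Left (flower h x + (flower k (- z) + nim S))"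
      by (intro options_plusI(2) stem_option that)
    ultimately show ?thesis by (rule wins_first_LeftI[rotated])
  qed
  show ?thesis
  proof (cases "h < k")
    \<comment> \<open>The pigeonhole choice \<open>j \<le> h\<close> satisfies \<open>j < k\<close>,
      so it is a legal cut of the red stem.\<close>
    case True
    then show ?thesis using ex_nim_avoiding_heap[of h c S] cut by (meson le_less_trans)
  next
    case False
    then have k: "k = h" and zx: "\<not> game_le x z" using assms(3) by (auto simp: outranks_def)
    have h: "2 \<le> h" using assms(1) k by simp
    show ?thesis
    proof (cases "wins_first c Left (nim (add_mset h (add_mset h S)))")
      case True
      show ?thesis
      proof (cases rule: nim_pair_step[OF x(1) True])
        case (1 j)
        then show ?thesis using cut k by blast
      next
        case (2 S')
        have "game_le z x" using numeric_linear zx x(2) assms(2) positive_def by blast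
        then have "\<not> wins_first c Right (flower h x + (flower h (- z) + nim S'))"
          using flower_pair_right_first[OF h x(2) assms(2)] 2 by blast
        moreover have "flower h x + (flower h (- z) + nim S') |\<in>|
            options_of Left (flower h x + (flower h (- z) + nim S))"
          by (intro options_plusI(2) 2)
        ultimately show ?thesis unfolding k by (rule wins_first_LeftI[rotated])
      qed
    next
      \<comment> \<open>The Nim invariant already holds, so Left moves in a Blossom; the failure of
        \<open>x \<le> z\<close> supplies a move after which the inequality between the blossoms
        needed by \<open>flower_pair_right_first\<close> holds.\<close>
      case False
      from zx consider x' where "x' |\<in>| left_opts x" "game_le z x'"
        | z' where "z' |\<in>| right_opts z" "game_le z' x"
        using game_le_iff[of x z] by blast
      then show ?thesis
      proof cases
        case 1
        have "positive x'" using 1 positive_le assms(2) numeric_left(1) x(2) positive_def by metis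
        then have "\<not> wins_first c Right (flower h x' + (flower h (- z) + nim S))"
          using flower_pair_right_first[OF h _ assms(2)] 1 False by blast
        moreover have "flower h x' + (flower h (- z) + nim S) |\<in>|
            options_of Left (flower h x + (flower h (- z) + nim S))"
          using 1 by (intro blossom_option) simp
        ultimately show ?thesis unfolding k by (rule wins_first_LeftI[rotated])
      next
        case 2
        then have "\<not> wins_first c Right (flower h x + (flower h (- z') + nim S))"
          using flower_pair_right_first[OF h x(2)] positive_right assms(2) False by blast
        moreover have "flower h x + (flower h (- z') + nim S) |\<in>|
            options_of Left (flower h x + (flower h (- z) + nim S))"
          using 2 left_option_uminus by (intro options_plusI(2) blossom_option) simp
        ultimately show ?thesis unfolding k by (rule wins_first_LeftI[rotated])
      qed
    qed
  qed
qed

text \<open>The reference Flower is not among the \<open>r\<close> others, so the clauses concern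
  advantages \<open>0\<close> and \<open>1\<close>. It is kept apart so that \<open>outranks\<close>
  still refers to it when only one pair is left.\<close>

lemma balanced_bed:
  assumes "2 \<le> k" and "positive z"
  shows "(bed k z (Suc r) r G \<longrightarrow> wins_first c Left (flower k (- z) + G)) \<and>
    (bed k z (Suc (Suc r)) r G \<longrightarrow> \<not> wins_first c Right (flower k (- z) + G))"
proof (induction "size G" arbitrary: r G rule: less_induct)
  case less
  have k: "1 \<le> k" using assms(1) by simp
  have nz: "numeric (- z)" using assms(2) numeric_uminus by (simp add: positive_def)
  have "wins_first c Left (flower k (- z) + G)" if G: "bed k z (Suc r) r G"
  proof (cases r)
    case 0
    then obtain h x G' where "outranks k z h x" "bed k z 0 0 G'" "G = flower h x + G'"
      using bed_split_blue G by metis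
    then show ?thesis
      using flower_pair_left_first[OF assms] bed_stalks by (metis add.left_commute)
  next
    case (Suc r')
    then obtain h x G' where G': "1 \<le> h" "bed k z (Suc (Suc r')) r' G'" "G = flower h x + G'"
      using bed_split_other G by metis
    then have o: "G' |\<in>| options_of Left G" using stem_option[of 0 h G' Left x] by simp
    then have "\<not> wins_first c Right (flower k (- z) + G')"
      using less.hyps[OF size_options_of] G'(2) by blast
    then show ?thesis using wins_first_LeftI[OF options_plusI(2)[OF o]] by simp
  qed
  moreover have "\<not> wins_first c Right (flower k (- z) + G)" if G: "bed k z (Suc (Suc r)) r G"
  proof (rule not_wins_firstI)
    fix K assume "K |\<in>| options_of Right (flower k (- z) + G)"
    then show "wins_first c (opponent Right) K"
    proof (cases rule: flower_plus_optionE)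
      case (stem i)
      then show ?thesis using bed_advantage[OF bed_add_heap[OF G]] by simp
    next
      \<comment> \<open>Once its Blossom has changed, the reference Flower is counted among the
        others, with advantage \<open>1\<close> and Left to move.\<close>
      case (blossom y)
      then show ?thesis
        using bed_advantage[OF bed.other[OF k _ G]] numeric_right(1)[OF nz] by simp
    next
      case (rest G')
      then obtain b' r' where G': "bed k z b' r' G'" "Suc (Suc r) + r' \<le> Suc (b' + r)"
        using bed_right_option G by blast
      \<comment> \<open>The bound leaves advantage \<open>0\<close>, where the induction hypothesis
        applies, or at least \<open>1\<close>, where \<open>bed_advantage\<close> does.\<close>
      show ?thesis
      proof (cases "b' = Suc r'")
        case True
        then show ?thesis using less.hyps[OF size_options_of[OF rest(1)]] rest(2) G'(1) by simp
      next
        case False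
        then show ?thesis
          using bed_advantage[OF bed.other[OF k nz G'(1)]] G'(2) rest(2) by simp
      qed
    qed
  qed (use options_flower_plus_nonempty k in blast)
  ultimately show ?case by blast
qed

section \<open>Hackenbush positions\<close>

lemma in_options_game_of:
  "G |\<in>| options_of p (game_of P) \<longleftrightarrow>
     (\<exists>e. e |\<in>| edges P \<and> may_cut p (colour_of P e) \<and> G = game_of (cut e P))"
  by (subst game_of.simps, cases p) auto

lemma left_opts_game_of:
  "G |\<in>| left_opts (game_of P) \<longleftrightarrow>
     (\<exists>e. e |\<in>| edges P \<and> may_cut Left (colour_of P e) \<and> G = game_of (cut e P))"
  and right_opts_game_of:
  "G |\<in>| right_opts (game_of P) \<longleftrightarrow>
     (\<exists>e. e |\<in>| edges P \<and> may_cut Right (colour_of P e) \<and> G = game_of (cut e P))"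
  using in_options_game_of[of G Left P] in_options_game_of[of G Right P] by simp_all

lemma may_cut_Green: "may_cut p Green"
  by (cases p) auto

section \<open>Cutting and connection to the ground\<close>

lemma cut_simps [simp]:
  "ends (cut e P) = ends P" "colour_of (cut e P) = colour_of P" "ground (cut e P) = ground P"
  by (simp_all add: cut_def discard_def)

lemma connected_to_ground_mono:
  assumes "connected_to_ground P v" and "edges P |\<subseteq>| edges Q"
    and "ends Q = ends P" and "ground Q = ground P"
  shows "connected_to_ground Q v"
  using assms
proof (induction rule: connected_to_ground.induct)
  case (ground v)
  then show ?case by (intro connected_to_ground.ground) simp
next
  case (edge v e w)
  then show ?case by (intro connected_to_ground.edge[of Q v e w]) auto
qed

lemma in_edges_discard:
  "e |\<in>| edges (discard P) \<longleftrightarrow>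
     e |\<in>| edges P \<and> (\<forall>v \<in> set_uprod (ends P e). connected_to_ground P v)"
  by (auto simp: discard_def)

lemma discard_simps [simp]:
  "ends (discard P) = ends P" "colour_of (discard P) = colour_of P" "ground (discard P) = ground P"
  by (simp_all add: discard_def)

lemma connected_to_ground_discard: "connected_to_ground (discard P) v \<longleftrightarrow> connected_to_ground P v"
proof
  assume "connected_to_ground P v"
  then show "connected_to_ground (discard P) v"
  proof (induction rule: connected_to_ground.induct)
    case (ground v)
    then show ?case by (intro connected_to_ground.ground) simp
  next
    case (edge v e w)
    have "connected_to_ground P w" using edge connected_to_ground.edge by metis
    then have "e |\<in>| edges (discard P)" using edge by (auto simp: in_edges_discard)
    then show ?case using edge by (intro connected_to_ground.edge[of _ v e w]) auto
  qed
qed (erule connected_to_ground_mono, auto simp: in_edges_discard)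

abbreviation delete :: "'e \<Rightarrow> ('v, 'e) hackenbush \<Rightarrow> ('v, 'e) hackenbush" where
  "delete e P \<equiv> P\<lparr>edges := edges P |-| {|e|}\<rparr>"

lemma in_edges_cut:
  "g |\<in>| edges (cut e P) \<longleftrightarrow>
     g |\<in>| edges P \<and> g \<noteq> e \<and> (\<forall>v \<in> set_uprod (ends P g). connected_to_ground (delete e P) v)"
  by (auto simp: cut_def in_edges_discard)

lemma edges_cut_subset: "edges (cut e P) |\<subseteq>| edges P"
  by (auto simp: in_edges_cut)

lemma grounded_cut: "grounded (cut e P)"
  by (auto simp: grounded_def cut_def in_edges_discard connected_to_ground_discard)

lemma red_blue_cut: "red_blue P \<Longrightarrow> red_blue (cut e P)"
  by (auto simp: red_blue_def in_edges_cut)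

lemma hackenbush_eqI:
  fixes P Q :: "('v, 'e) hackenbush"
  assumes "\<And>e. e |\<in>| edges P \<longleftrightarrow> e |\<in>| edges Q" "ends P = ends Q" "colour_of P = colour_of Q"
    "ground P = ground Q"
  shows "P = Q"
  using assms by (auto intro: hackenbush.equality simp: fset_eq_iff)

text \<open>Edges discarded after the first cut lie on no path from the ground, so discarding once
  at the end is enough.\<close>

lemma cut_cut: "cut f (cut e P) = discard (delete f (delete e P))"
proof (rule hackenbush_eqI)
  fix g
  have "connected_to_ground (delete f (cut e P)) v \<longleftrightarrow>
      connected_to_ground (delete f (delete e P)) v" for v
  proof
    assume "connected_to_ground (delete f (delete e P)) v"
    then have "connected_to_ground (discard (delete f (delete e P))) v"
      by (simp add: connected_to_ground_discard)
    then show "connected_to_ground (delete f (cut e P)) v"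
    proof (rule connected_to_ground_mono)
      have "connected_to_ground (delete e P) v" if "connected_to_ground (delete f (delete e P)) v" for v
        using that by (rule connected_to_ground_mono) auto
      then show "edges (discard (delete f (delete e P))) |\<subseteq>| edges (delete f (cut e P))"
        by (auto simp: in_edges_discard in_edges_cut)
    qed simp_all
  next
    assume "connected_to_ground (delete f (cut e P)) v"
    then show "connected_to_ground (delete f (delete e P)) v"
      by (rule connected_to_ground_mono) (auto simp: in_edges_cut)
  qed
  moreover have "connected_to_ground (delete e P) v" if "connected_to_ground (delete f (delete e P)) v" for v
    using that by (rule connected_to_ground_mono) auto
  ultimately show "g |\<in>| edges (cut f (cut e P)) \<longleftrightarrow> g |\<in>| edges (discard (delete f (delete e P)))"
    unfolding in_edges_cut[of g f] in_edges_discard by (auto simp: in_edges_cut)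
qed simp_all

lemma cut_commute: "cut f (cut e P) = cut e (cut f P)"
proof -
  have "delete f (delete e P) = delete e (delete f P)" by (rule hackenbush_eqI) auto
  then show ?thesis by (simp only: cut_cut)
qed

lemma cut_absent:
  assumes "grounded P" and "e |\<notin>| edges P"
  shows "cut e P = P"
proof (rule hackenbush_eqI)
  have "delete e P = P" using assms(2) by (intro hackenbush_eqI) auto
  then show "g |\<in>| edges (cut e P) \<longleftrightarrow> g |\<in>| edges P" for g
    using assms by (auto simp: in_edges_cut grounded_def)
qed simp_all

text \<open>Of two edges, the one that can be reached without the other is not lost by cutting the
  other.\<close>

lemma cut_antisym:
  assumes "grounded P" and "e |\<in>| edges P" and "f |\<in>| edges P" and "e \<noteq> f"
    and "f |\<notin>| edges (cut e P)"
  shows "e |\<in>| edges (cut f P)"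
proof (rule ccontr)
  assume e: "e |\<notin>| edges (cut f P)"
  let ?Q = "delete f (delete e P)"
  have Qe: "connected_to_ground (delete e P) v" if "connected_to_ground ?Q v" for v
    using that by (rule connected_to_ground_mono) auto
  have Qf: "connected_to_ground (delete f P) v" if "connected_to_ground ?Q v" for v
    using that by (rule connected_to_ground_mono) auto
  \<comment> \<open>On a path from the ground, the first of \<open>e\<close> and \<open>f\<close>
    would be reached without the other and hence survive the other's cut. So no path uses
    either.\<close>
  have Q: "connected_to_ground ?Q v" if "connected_to_ground P v" for v
    using that
  proof (induction rule: connected_to_ground.induct)
    case (ground v)
    then show ?case by (intro connected_to_ground.ground) simp
  next
    case (edge v g w)
    consider "g = e" | "g = f" | "g \<noteq> e" "g \<noteq> f" by blast
    then show ?case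
    proof cases
      case 1
      then have "connected_to_ground (delete f P) w"
        using edge Qf assms(4) by (intro connected_to_ground.edge[of _ v g w]) auto
      then show ?thesis using e edge 1 Qf[of v] assms(2,4) by (auto simp: in_edges_cut)
    next
      case 2
      then have "connected_to_ground (delete e P) w"
        using edge Qe assms(4) by (intro connected_to_ground.edge[of _ v g w]) auto
      then show ?thesis using assms(5) edge 2 Qe[of v] assms(3,4) by (auto simp: in_edges_cut)
    next
      case 3
      then show ?thesis using edge by (intro connected_to_ground.edge[of _ v g w]) auto
    qed
  qed
  then have "f |\<in>| edges (cut e P)"
    using assms(1,3,4) Qe by (auto simp: in_edges_cut grounded_def)
  then show False using assms(5) by blast
qed

text \<open>For blue \<open>e\<close>, a Right cut of \<open>f\<close> in \<open>P\<close> is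
  matched by the same cut in \<open>cut e P\<close> if \<open>f\<close> survived. If
  \<open>f\<close> was lost with \<open>e\<close>, Left cuts \<open>e\<close> after \<open>f\<close>
  and reaches \<open>cut e P\<close> itself. Red is dual.\<close>

lemma game_le_cut:
  assumes "grounded P" and "red_blue P" and "e |\<in>| edges P"
  shows "(colour_of P e = Blue \<longrightarrow> game_le (game_of (cut e P)) (game_of P)) \<and>
    (colour_of P e = Red \<longrightarrow> game_le (game_of P) (game_of (cut e P)))"
  using assms
proof (induction "fcard (edges P)" arbitrary: P rule: less_induct)
  case less
  have mem: "e |\<in>| edges (cut f P)"
    if "f |\<in>| edges P" "f \<noteq> e" "f |\<notin>| edges (cut e P)" for f
    using cut_antisym[of P e f] less.prems that by blast
  \<comment> \<open>If cutting \<open>f\<close> already discards \<open>e\<close>, both sides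
    coincide by \<open>cut_absent\<close>.\<close>
  have IH: "colour_of P e = Blue \<Longrightarrow> game_le (game_of (cut f (cut e P))) (game_of (cut f P))"
    "colour_of P e = Red \<Longrightarrow> game_le (game_of (cut f P)) (game_of (cut f (cut e P)))"
    if "f |\<in>| edges P" for f
    using less.hyps[of "cut f P"] fcard_edges_cut[OF that] grounded_cut[of f P]
      red_blue_cut[OF less.prems(2), of f] cut_absent[of "cut f P" e] game_le_refl
    by (cases "e |\<in>| edges (cut f P)"; simp add: cut_commute[of e f])+
  show ?case
  proof (intro conjI impI)
    assume blue: "colour_of P e = Blue"
    show "game_le (game_of (cut e P)) (game_of P)"
      unfolding game_le_iff[of "game_of (cut e P)"]
    proof (intro conjI allI impI)
      fix H assume "H |\<in>| right_opts (game_of P)"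
      then obtain f where f: "f |\<in>| edges P" "may_cut Right (colour_of P f)" "H = game_of (cut f P)"
        by (auto simp: right_opts_game_of)
      then have "f \<noteq> e" using blue by auto
      show "\<not> game_le H (game_of (cut e P))"
      proof (cases "f |\<in>| edges (cut e P)")
        case True
        then have "game_of (cut f (cut e P)) |\<in>| right_opts (game_of (cut e P))"
          using f by (auto simp: right_opts_game_of)
        then show ?thesis using IH(1)[OF f(1) blue] f(3) game_le_iff[of H] by blast
      next
        case False
        then have "game_of (cut e (cut f P)) |\<in>| left_opts H"
          using mem[OF f(1) \<open>f \<noteq> e\<close>] f(3) blue by (auto simp: left_opts_game_of)
        moreover have "cut e (cut f P) = cut e P"
          using cut_absent[of "cut e P" f] False grounded_cut by (metis cut_commute)
        ultimately show ?thesis using game_le_iff[of H] game_le_refl by metis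
      qed
    next
      fix G assume "G |\<in>| left_opts (game_of (cut e P))"
      then obtain f where f: "f |\<in>| edges P" "may_cut Left (colour_of P f)"
          "G = game_of (cut f (cut e P))"
        using edges_cut_subset by (fastforce simp: left_opts_game_of)
      then have "game_of (cut f P) |\<in>| left_opts (game_of P)" by (auto simp: left_opts_game_of)
      then show "\<not> game_le (game_of P) G"
        using IH(1)[OF f(1) blue] f(3) game_le_iff[of "game_of P" G] by blast
    qed
  next
    assume red: "colour_of P e = Red"
    show "game_le (game_of P) (game_of (cut e P))"
      unfolding game_le_iff[of "game_of P"]
    proof (intro conjI allI impI)
      fix G assume "G |\<in>| left_opts (game_of P)"
      then obtain f where f: "f |\<in>| edges P" "may_cut Left (colour_of P f)" "G = game_of (cut f P)"
        by (auto simp: left_opts_game_of)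
      then have "f \<noteq> e" using red by auto
      show "\<not> game_le (game_of (cut e P)) G"
      proof (cases "f |\<in>| edges (cut e P)")
        case True
        then have "game_of (cut f (cut e P)) |\<in>| left_opts (game_of (cut e P))"
          using f by (auto simp: left_opts_game_of)
        then show ?thesis using IH(2)[OF f(1) red] f(3) game_le_iff[of _ G] by blast
      next
        case False
        then have "game_of (cut e (cut f P)) |\<in>| right_opts G"
          using mem[OF f(1) \<open>f \<noteq> e\<close>] f(3) red by (auto simp: right_opts_game_of)
        moreover have "cut e (cut f P) = cut e P"
          using cut_absent[of "cut e P" f] False grounded_cut by (metis cut_commute)
        ultimately show ?thesis using game_le_iff[of _ G] game_le_refl by metis
      qed
    next
      fix H assume "H |\<in>| right_opts (game_of (cut e P))"
      then obtain f where f: "f |\<in>| edges P" "may_cut Right (colour_of P f)"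
          "H = game_of (cut f (cut e P))"
        using edges_cut_subset by (fastforce simp: right_opts_game_of)
      then have "game_of (cut f P) |\<in>| right_opts (game_of P)" by (auto simp: right_opts_game_of)
      then show "\<not> game_le H (game_of P)"
        using IH(2)[OF f(1) red] f(3) game_le_iff[of H "game_of P"] by blast
    qed
  qed
qed

lemma numeric_game_of:
  assumes "grounded P" and "red_blue P"
  shows "numeric (game_of P)"
  using assms
proof (induction "fcard (edges P)" arbitrary: P rule: less_induct)
  case less
  have num: "numeric (game_of (cut e P))" if "e |\<in>| edges P" for e
    using less.hyps[OF fcard_edges_cut[OF that] grounded_cut red_blue_cut] less.prems by blast
  show ?case
  proof (rule numeric.intros)
    fix G assume "G |\<in>| left_opts (game_of P)"
    then obtain e where "e |\<in>| edges P" "may_cut Left (colour_of P e)" "G = game_of (cut e P)"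
      by (auto simp: left_opts_game_of)
    then show "numeric G \<and> game_le G (game_of P)"
      using num[of e] game_le_cut[OF less.prems, of e] less.prems(2) by (auto simp: red_blue_def)
  next
    fix G assume "G |\<in>| right_opts (game_of P)"
    then obtain e where "e |\<in>| edges P" "may_cut Right (colour_of P e)" "G = game_of (cut e P)"
      by (auto simp: right_opts_game_of)
    then show "numeric G \<and> game_le (game_of P) G"
      using num[of e] game_le_cut[OF less.prems, of e] less.prems(2) by (auto simp: red_blue_def)
  qed
qed

section \<open>Flower positions\<close>

text \<open>The maps \<open>j\<close> and \<open>w\<close> embed a path in an arbitrary position, to
  serve Stalks and Flowers alike. The edges of \<open>D\<close> can touch the path only at its top
  \<open>w h\<close>, so every stem cut discards them.\<close>

lemma cut_stem_edge:
  assumes ground: "ground P = {|w 0|}"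
    and edges: "edges P = j |`| fset_of_list [0..<h] |\<union>| D"
    and "inj j" and "inj w"
    and stem: "\<And>i. i < h \<Longrightarrow> ends P (j i) = Upair (w i) (w (Suc i))"
    and D: "\<And>d i. d |\<in>| D \<Longrightarrow> i < h \<Longrightarrow> w i \<notin> set_uprod (ends P d)"
    and "i < h"
  shows "cut (j i) P = P\<lparr>edges := j |`| fset_of_list [0..<i]\<rparr>"
proof (rule hackenbush_eqI)
  let ?P' = "delete (j i) P"
  have in_edges: "g |\<in>| edges P \<longleftrightarrow> (\<exists>b<h. g = j b) \<or> g |\<in>| D" for g
    unfolding edges by (auto simp: fset_of_list_elem)
  have up: "connected_to_ground ?P' (w a)" if "a \<le> i" for a
    using that
  proof (induction a)
    case 0
    then show ?case using ground by (intro connected_to_ground.ground) simp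
  next
    case (Suc a)
    have "j a |\<in>| edges P"
      using Suc.prems \<open>i < h\<close> in_edges[of "j a"] by (metis Suc_le_lessD less_trans)
    then have "j a |\<in>| edges ?P'"
      using Suc.prems injD[OF \<open>inj j\<close>, of a i] by auto
    moreover have "ends ?P' (j a) = Upair (w a) (w (Suc a))"
      using stem[of a] Suc.prems \<open>i < h\<close> by simp
    ultimately show ?case
      using connected_to_ground.edge Suc.IH Suc.prems by (metis Suc_leD)
  qed
  \<comment> \<open>The path leads upwards from \<open>w i\<close> only through \<open>j i\<close>,
    and \<open>D\<close> avoids \<open>w 0\<close> to \<open>w i\<close>.\<close>
  have down: "\<exists>a\<le>i. v = w a" if "connected_to_ground ?P' v" for v
    using that
  proof (induction rule: connected_to_ground.induct)
    case (ground v)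
    then show ?case using assms(1) by auto
  next
    case (edge v e v')
    then obtain a where a: "a \<le> i" "v = w a" by blast
    have "e |\<notin>| D" using D[of e a] a edge.hyps(3) \<open>i < h\<close> by auto
    then obtain b where b: "b < h" "e = j b" "b \<noteq> i"
      using edge.hyps(2) in_edges[of e] by auto
    have "Upair (w b) (w (Suc b)) = Upair (w a) v'"
      using stem[OF b(1)] edge.hyps(3) unfolding a(2) b(2) by simp
    then have "a = b \<and> v' = w (Suc b) \<or> a = Suc b \<and> v' = w b"
      unfolding Upair_inject inj_eq[OF \<open>inj w\<close>] by (elim disjE conjE) simp_all
    then show ?case
    proof
      assume "a = b \<and> v' = w (Suc b)"
      then show ?thesis using a b by (intro exI[of _ "Suc b"]) simp
    next
      assume "a = Suc b \<and> v' = w b"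
      then show ?thesis using a by (intro exI[of _ b]) simp
    qed
  qed
  show "g |\<in>| edges (cut (j i) P) \<longleftrightarrow> g |\<in>| edges (P\<lparr>edges := j |`| fset_of_list [0..<i]\<rparr>)" for g
  proof
    assume "g |\<in>| edges (cut (j i) P)"
    then have g: "g |\<in>| edges P" "g \<noteq> j i"
        "\<And>v. v \<in> set_uprod (ends P g) \<Longrightarrow> connected_to_ground ?P' v"
      by (simp_all add: in_edges_cut)
    obtain x y where xy: "ends P g = Upair x y" by (cases "ends P g")
    then obtain k where k: "k \<le> i" "x = w k" using g(3)[of x] down[of x] by auto
    then have "g |\<notin>| D" using D[of g k] xy \<open>i < h\<close> by auto
    then obtain b where b: "b < h" "g = j b" "b \<noteq> i" using g(1,2) in_edges[of g] by blast
    then have "connected_to_ground ?P' (w (Suc b))" using g(3) stem[of b] by simp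
    then obtain k where "k \<le> i" "w (Suc b) = w k" using down by blast
    then have "b < i" using injD[OF \<open>inj w\<close>] by fastforce
    then show "g |\<in>| edges (P\<lparr>edges := j |`| fset_of_list [0..<i]\<rparr>)"
      using b by (simp add: fset_of_list_elem)
  next
    assume "g |\<in>| edges (P\<lparr>edges := j |`| fset_of_list [0..<i]\<rparr>)"
    then obtain b where b: "b < i" "g = j b" by (auto simp: fset_of_list_elem)
    have "b < h" using b(1) \<open>i < h\<close> by simp
    then have "g |\<in>| edges P" using b(2) in_edges by blast
    moreover have "g \<noteq> j i" using injD[OF \<open>inj j\<close>, of b i] b by auto
    moreover have "ends P g = Upair (w b) (w (Suc b))" using stem[OF \<open>b < h\<close>] b(2) by simp
    ultimately show "g |\<in>| edges (cut (j i) P)"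
      using up[of b] up[of "Suc b"] b(1) unfolding in_edges_cut by simp
  qed
qed simp_all

lemma game_of_path:
  assumes "ground P = {|w 0|}" and "edges P = j |`| fset_of_list [0..<h]"
    and "inj j" and "inj w"
    and "\<And>i. i < h \<Longrightarrow> ends P (j i) = Upair (w i) (w (Suc i))"
    and "\<And>i. i < h \<Longrightarrow> colour_of P (j i) = Green"
  shows "game_of P = heap h"
  using assms
proof (induction h arbitrary: P rule: less_induct)
  case (less h)
  have "game_of (cut (j i) P) = heap i" if "i < h" for i
    using cut_stem_edge[of P w j h "{||}" i] less.prems that
    by (simp add: less.IH[of i])
  moreover have "e |\<in>| edges P \<longleftrightarrow> (\<exists>i<h. e = j i)" for e
    unfolding less.prems(2) by (auto simp: fset_of_list_elem)
  ultimately show ?case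
    using less.prems(6) may_cut_Green
    by (intro game_eqI) (metis in_options_game_of in_options_heap)
qed

lemma game_of_stalk: "game_of (stalk h) = heap h"
  by (rule game_of_path[of _ id id]) (auto simp: stalk_def)

lemma map_uprod_eq_Upair:
  "map_uprod f u = Upair x y \<Longrightarrow> \<exists>a b. u = Upair a b \<and> x = f a \<and> y = f b"
  by (cases u) (auto simp: Upair_inject; metis Upair_inject)

lemma flower_position_sel:
  "edges (flower_position (Flower h B)) = Inl |`| fset_of_list [0..<h] |\<union>| Inr |`| edges B"
  "ends (flower_position (Flower h B)) (Inl i) = Upair (Inl i) (Inl (Suc i))"
  "ends (flower_position (Flower h B)) (Inr e) =
     map_uprod (\<lambda>v. if v |\<in>| ground B then Inl h else Inr v) (ends B e)"
  "colour_of (flower_position (Flower h B)) (Inl i) = Green"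
  "colour_of (flower_position (Flower h B)) (Inr e) = colour_of B e"
  "ground (flower_position (Flower h B)) = {|Inl 0|}"
  by (simp_all add: flower_position_def stalk_def cong: if_cong)

text \<open>The intact stem joins the ground to its top, so connection in the Flower and in the
  Blossom agree under the attaching map \<open>\<phi>\<close>.\<close>

lemma cut_blossom_edge:
  "cut (Inr e) (flower_position (Flower h B)) = flower_position (Flower h (cut e B))"
proof (rule hackenbush_eqI)
  let ?F = "flower_position (Flower h B)"
  let ?F' = "delete (Inr e) ?F"
  define \<phi> where "\<phi> v = (if v |\<in>| ground B then Inl h else Inr v)" for v
  note sel = flower_position_sel[of h B, folded \<phi>_def]
  have inl: "Inl i |\<in>| edges ?F' \<longleftrightarrow> i < h" for i
    by (auto simp: sel fset_of_list_elem)
  have inr: "Inr d |\<in>| edges ?F' \<longleftrightarrow> d |\<in>| edges (delete e B)" for d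
    by (auto simp: sel)
  have ends: "ends ?F' (Inl i) = Upair (Inl i) (Inl (Suc i))"
    "ends ?F' (Inr d) = map_uprod \<phi> (ends (delete e B) d)" for i d
    by (simp_all add: sel)
  have stem: "connected_to_ground ?F' (Inl i)" if "i \<le> h" for i
    using that
  proof (induction i)
    case 0
    then show ?case by (intro connected_to_ground.ground) (simp add: sel)
  next
    case (Suc i)
    then show ?case using connected_to_ground.edge[OF _ _ ends(1)] inl by simp
  qed
  have "connected_to_ground ?F' (\<phi> v)" if "connected_to_ground (delete e B) v" for v
    using that
  proof (induction rule: connected_to_ground.induct)
    case (ground v)
    then show ?case using stem[of h] by (simp add: \<phi>_def)
  next
    case (edge v g w)
    have "ends ?F' (Inr g) = Upair (\<phi> v) (\<phi> w)" unfolding ends edge.hyps(3) by simp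
    then show ?case using connected_to_ground.edge[OF edge.IH] inr edge.hyps(2) by blast
  qed
  moreover have "connected_to_ground (delete e B) v" if "connected_to_ground ?F' (\<phi> v)" for v
  proof -
    \<comment> \<open>\<open>\<phi>\<close> need not be injective on ground vertices, so the
      induction covers every \<open>v\<close> with \<open>\<phi> v = x\<close>. Ground vertices are
      trivial, and elsewhere the preimage is unique.\<close>
    have "\<phi> v = x \<Longrightarrow> connected_to_ground (delete e B) v" if "connected_to_ground ?F' x" for v x
      using that
    proof (induction arbitrary: v rule: connected_to_ground.induct)
      case (ground x)
      then have "v |\<in>| ground B" by (auto simp: sel \<phi>_def split: if_splits)
      then show ?case by (intro connected_to_ground.ground) simp
    next
      case (edge x g y)
      show ?case
      proof (cases "v |\<in>| ground B")
        case True
        then show ?thesis by (intro connected_to_ground.ground) simp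
      next
        case False
        then have y: "y = Inr v" using edge.prems by (simp add: \<phi>_def)
        then obtain d where d: "g = Inr d"
          using edge.hyps(3) ends(1) by (cases g) auto
        then obtain a b where ab: "ends (delete e B) d = Upair a b" "x = \<phi> a" "y = \<phi> b"
          using edge.hyps(3) map_uprod_eq_Upair[of \<phi> _ x y] unfolding d ends by blast
        then have "b = v" using y by (simp add: \<phi>_def split: if_splits)
        then show ?thesis
          using ab edge.IH[of a] edge.hyps(2) inr d connected_to_ground.edge by metis
      qed
    qed
    then show ?thesis using that by blast
  qed
  ultimately have conn: "connected_to_ground ?F' (\<phi> v) \<longleftrightarrow> connected_to_ground (delete e B) v" for v
    by blast
  show "g |\<in>| edges (cut (Inr e) ?F) \<longleftrightarrow> g |\<in>| edges (flower_position (Flower h (cut e B)))" for g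
  proof (cases g)
    case (Inl i)
    then show ?thesis
      using stem[of i] stem[of "Suc i"]
      by (auto simp: in_edges_cut flower_position_sel(1) sel fset_of_list_elem)
  next
    case (Inr d)
    have "g |\<in>| edges (cut (Inr e) ?F) \<longleftrightarrow>
        d |\<in>| edges B \<and> d \<noteq> e \<and> (\<forall>v \<in> set_uprod (ends B d). connected_to_ground ?F' (\<phi> v))"
      unfolding in_edges_cut Inr by (auto simp: sel uprod.set_map)
    also have "\<dots> \<longleftrightarrow> d |\<in>| edges (cut e B)"
      unfolding conn by (simp add: in_edges_cut)
    also have "\<dots> \<longleftrightarrow> g |\<in>| edges (flower_position (Flower h (cut e B)))"
      by (auto simp: Inr flower_position_sel(1))
    finally show ?thesis .
  qed
qed (simp_all add: flower_position_def Let_def cong: if_cong)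

lemma game_of_flower_position: "game_of (flower_position (Flower h B)) = flower h (game_of B)"
proof (induction "fcard (edges B)" arbitrary: B rule: less_induct)
  case less
  let ?F = "flower_position (Flower h B)"
  have stem: "game_of (cut (Inl i) ?F) = heap i" if "i < h" for i
  proof -
    have "cut (Inl i) ?F = ?F\<lparr>edges := Inl |`| fset_of_list [0..<i]\<rparr>"
      using that
      by (intro cut_stem_edge[where w = Inl and D = "Inr |`| edges B" and h = h])
        (auto simp: flower_position_sel uprod.set_map fset_of_list_elem split: if_splits)
    also have "game_of \<dots> = heap i"
      by (rule game_of_path[of _ Inl Inl]) (auto simp: flower_position_sel)
    finally show ?thesis .
  qed
  have blossom: "game_of (cut (Inr e) ?F) = flower h (game_of (cut e B))" if "e |\<in>| edges B" for e
    unfolding cut_blossom_edge using less fcard_edges_cut[OF that] by blast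
  show ?case
  proof (rule game_eqI)
    fix p G
    have "e |\<in>| edges ?F \<longleftrightarrow> (\<exists>i<h. e = Inl i) \<or> (\<exists>d. d |\<in>| edges B \<and> e = Inr d)" for e
      by (auto simp: flower_position_sel fset_of_list_elem)
    then have "G |\<in>| options_of p (game_of ?F) \<longleftrightarrow>
        (\<exists>i<h. G = game_of (cut (Inl i) ?F)) \<or>
        (\<exists>e. e |\<in>| edges B \<and> may_cut p (colour_of B e) \<and> G = game_of (cut (Inr e) ?F))"
      unfolding in_options_game_of[of G p ?F]
      by (metis flower_position_sel(4,5) may_cut_Green)
    also have "\<dots> \<longleftrightarrow> G |\<in>| options_of p (flower h (game_of B))"
      using stem blossom unfolding in_options_flower in_options_game_of by metis
    finally show "G |\<in>| options_of p (game_of ?F) \<longleftrightarrow> G |\<in>| options_of p (flower h (game_of B))" .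
  qed
qed

section \<open>Generalized Flowerbeds\<close>

lemma bed_add_blue_flowers:
  assumes "\<forall>f\<in>#M. outranks k z (height f) (game_of (blossom f))" and "bed k z b r G"
  shows "bed k z (b + size M) r ((\<Sum>f\<in>#M. game_of (flower_position f)) + G)"
  using assms(1)
proof (induction M)
  case empty
  then show ?case using assms(2) by simp
next
  case (add f M)
  have "game_of (flower_position f) = flower (height f) (game_of (blossom f))"
    using game_of_flower_position by (metis flower.collapse)
  then show ?case using add bed.blue[of k z "height f" "game_of (blossom f)"] by (simp add: add.assoc)
qed

lemma bed_add_generalized_flowers:
  assumes "\<forall>f\<in>#M. generalized_flower f" and "bed k z b r G"
  shows "bed k z b (r + size M) ((\<Sum>f\<in>#M. game_of (flower_position f)) + G)"
  using assms(1)
proof (induction M)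
  case empty
  then show ?case using assms(2) by simp
next
  case (add f M)
  have "game_of (flower_position f) = flower (height f) (game_of (blossom f))"
    using game_of_flower_position by (metis flower.collapse)
  moreover have "1 \<le> height f" "numeric (game_of (blossom f))"
    using add.prems numeric_game_of by (auto simp: generalized_flower_def)
  ultimately show ?case
    using add bed.other[of "height f" "game_of (blossom f)"] by (simp add: add.assoc)
qed

lemma value_of_le: "value_of G \<le> value_of H \<longleftrightarrow> game_le G H"
  by (rule less_eq_value.abs_eq)

lemma zero_value: "0 = value_of 0"
  by (rule zero_value.abs_eq)

lemma uminus_value: "- value_of G = value_of (- G)"
  by (rule uminus_value.abs_eq)

lemma blue_flower_positive: "blue_flower f \<Longrightarrow> positive (game_of (blossom f))"
  using numeric_game_of
  by (auto simp: blue_flower_def generalized_flower_def blossom_value_def positive_def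
      less_value_def zero_value value_of_le)

lemma red_flower_negative: "red_flower f \<Longrightarrow> positive (- game_of (blossom f))"
  using numeric_game_of game_le_uminus[of "- game_of (blossom f)" 0]
  by (auto simp: red_flower_def generalized_flower_def blossom_value_def positive_def
      less_value_def zero_value value_of_le uminus_uminus_game uminus_zero_game
      intro: numeric_uminus)

text \<open>A blue Flower higher than \<open>r\<close> would be weaker. At equal heights,
  \<open>x \<le> z\<close> and \<open>\<not> weaker f r\<close> force equal absolute values, and
  then the Flowers cancel.\<close>

lemma blue_outranks_weakest_red:
  assumes "blue_flower f" and "red_flower r" and "\<not> weaker f r" and "\<not> cancel f r"
  shows "outranks (height r) (- game_of (blossom r)) (height f) (game_of (blossom f))"
proof -
  let ?x = "game_of (blossom f)" and ?z = "- game_of (blossom r)"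
  have x: "positive ?x" and z: "positive ?z"
    using assms blue_flower_positive red_flower_negative by blast+
  have "\<not> game_le ?x ?z" if h: "height f = height r"
  proof
    assume le: "game_le ?x ?z"
    have "\<not> 0 \<le> blossom_value r" "0 \<le> blossom_value f"
      using assms(1,2) by (auto simp: red_flower_def blue_flower_def less_value_def)
    then have abs: "\<bar>blossom_value f\<bar> = value_of ?x" "\<bar>blossom_value r\<bar> = value_of ?z"
      by (simp_all add: abs_value_def blossom_value_def uminus_value)
    have "\<not> value_of ?x < value_of ?z" using assms(3) h abs by (simp add: weaker_def)
    then have "value_of ?z \<le> value_of ?x" using le by (simp add: less_value_def value_of_le)
    then have "value_of ?x = value_of ?z" using le by (intro antisym) (simp_all add: value_of_le)
    then have "- blossom_value f = blossom_value r"
      unfolding blossom_value_def uminus_value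
      using uminus_value[of ?x] uminus_value[of ?z] by (simp add: uminus_uminus_game)
    then show False using assms(4) h by (simp add: cancel_def)
  qed
  moreover have "1 \<le> height f" "\<not> height r < height f"
    using assms by (auto simp: blue_flower_def generalized_flower_def weaker_def)
  ultimately show ?thesis using x by (auto simp: outranks_def)
qed

theorem theorem4p11:
  fixes F :: "('v, 'e) flowerbed" and n :: nat
  assumes "generalized_flowerbed n F"
    and "\<exists>f \<in># blue_flowers F + red_flowers F. height f \<ge> 2"
    and "\<forall>b \<in># blue_flowers F. \<forall>r \<in># red_flowers F. \<not> cancel b r"
    and "\<exists>r \<in># red_flowers F. weakest_in r F"
  shows "(\<forall>c. \<exists>G. winning_move c Left (flowerbed_game F) G) \<and>
    (n \<ge> 2 \<longrightarrow> (\<exists>G. \<forall>c. winning_move c Left (flowerbed_game F) G))"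
proof -
  let ?g = "\<lambda>f :: ('v, 'e) flower. game_of (flower_position f)"
  obtain r where r: "r \<in># red_flowers F" "weakest_in r F" using assms(4) by blast
  define k z R where "k = height r" and "z = - game_of (blossom r)"
    and "R = red_flowers F - {#r#}"
  have R: "red_flowers F = add_mset r R" using r(1) by (simp add: R_def)
  have blue: "\<forall>f\<in>#blue_flowers F. blue_flower f" and red: "\<forall>f\<in>#red_flowers F. red_flower f"
    and size: "size (blue_flowers F) = n" "n = Suc (size R)"
    using assms(1) by (auto simp: generalized_flowerbed_def R)
  have weakest: "\<not> weaker f r" if "f \<in># blue_flowers F + red_flowers F" for f
    using r(2) that by (simp add: weakest_in_def)
  \<comment> \<open>A weakest Flower has maximal height.\<close>
  have k: "2 \<le> k"
  proof -
    obtain f where "f \<in># blue_flowers F + red_flowers F" "2 \<le> height f" using assms(2) by blast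
    then show ?thesis using weakest[of f] by (simp add: weaker_def k_def)
  qed
  have z: "positive z" unfolding z_def using red_flower_negative red r(1) by blast
  have rank: "\<forall>f\<in>#blue_flowers F. outranks k z (height f) (game_of (blossom f))"
  proof
    fix f assume f: "f \<in># blue_flowers F"
    then have "\<not> weaker f r" "\<not> cancel f r" using weakest[of f] assms(3) r(1) by simp_all
    then show "outranks k z (height f) (game_of (blossom f))"
      unfolding k_def z_def using blue_outranks_weakest_red blue red f r(1) by blast
  qed
  \<comment> \<open>Everything but the reference Flower, with \<open>M\<close> as the other red
    Flowers; it is used for \<open>R\<close> and for \<open>R\<close> less one Flower.\<close>
  define H where "H M = (\<Sum>f\<in>#blue_flowers F. ?g f) + ((\<Sum>f\<in>#M. ?g f) + nim (stalk_heights F))"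
    for M
  have bed: "bed k z n (size M) (H M)" if "M \<subseteq># R" for M
  proof -
    have "\<forall>f\<in>#M. generalized_flower f"
      using red that by (auto simp: R red_flower_def dest: mset_subset_eqD)
    then have "bed k z 0 (size M) ((\<Sum>f\<in>#M. ?g f) + nim (stalk_heights F))"
      using bed_add_generalized_flowers[OF _ bed.stalks] by fastforce
    then show ?thesis
      using bed_add_blue_flowers[OF rank] size(1) unfolding H_def by fastforce
  qed
  have "?g r = flower k (- z)"
    using game_of_flower_position by (metis flower.collapse k_def uminus_uminus_game z_def)
  then have F: "flowerbed_game F = flower k (- z) + H R"
    unfolding flowerbed_game_def H_def R
    by (simp add: game_of_stalk add.assoc add.left_commute)
  have win: "wins_first c Left (flowerbed_game F)" for c
    using balanced_bed[OF k z] bed[of R] unfolding F size(2) by blast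
  have "1 \<le> k" using k by simp
  then have "options_of Left (flowerbed_game F) \<noteq> {||}"
    unfolding F by (rule options_flower_plus_nonempty)
  then have "\<exists>G. winning_move c Left (flowerbed_game F) G" for c
    unfolding winning_move_def using wins_first_LeftE[OF win] by (metis opponent.simps(1))
  moreover have "\<exists>G. \<forall>c. winning_move c Left (flowerbed_game F) G" if "2 \<le> n"
  proof -
    have "R \<noteq> {#}" using that size(2) by auto
    then obtain s M where M: "R = add_mset s M" by (meson multiset_cases)
    have "1 \<le> height s"
      using red by (simp add: R M red_flower_def generalized_flower_def)
    then have "0 + H M |\<in>| options_of Left (?g s + H M)"
      using stem_option[of 0 "height s"] game_of_flower_position
      by (metis flower.collapse heap_0 less_eq_Suc_le One_nat_def)
    moreover have "H R = ?g s + H M" by (simp add: H_def M add.assoc add.left_commute)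
    ultimately have "flower k (- z) + H M |\<in>| options_of Left (flowerbed_game F)"
      unfolding F by (simp only: add_0 options_plusI(2))
    moreover have "\<not> wins_first c Right (flower k (- z) + H M)" for c
      using balanced_bed[OF k z, of "size M" "H M" c] bed[of M] size(2) M by simp
    ultimately show ?thesis unfolding winning_move_def by (metis opponent.simps(1))
  qed
  ultimately show ?thesis by blast
qed

end
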